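(* Let $f$ be a Schwarz-Christoffel mapping of the unit disk $\mathbb{D}$ onto the exterior of an $(n+2)$-gon with $f(0)=\infty$, given by $$z\frac{f''}{f'}(z)=\frac{2}{z^2(B_1(z)/B_2(z))-1},$$ where $B_1,B_2$ are finite Blaschke products without common zeros, of respective degrees $d_1,d_2$ with $d_1+d_2=n$, and suppose that $d_2\geq 1$. Suppose that all the zeros of $B_1,B_2$ are contained in the subdisk $|z|\leq r<1$. Then $$r\ \geq\ \max\left\{\frac{\sqrt{d_1d_2+4}+2-d_2}{\sqrt{d_1d_2+4}+2+d_2}\,,\ \frac{d_2-1-\sqrt{1+d_1d_2}}{d_2+1+\sqrt{1+d_1d_2}}\right\}.$$
   Context: $\mathbb{D}=\{|z|<1\}$. A Schwarz-Christoffel mapping onto the exterior of an $(n+2)$-gon is a conformal (meromorphic, univalent) map $f$ of $\mathbb{D}$ onto the complement, in the extended complex plane, of a bounded polygon with $n+2$ vertices, normalized by $f(0)=\infty$. It satisfies $$\frac{f''}{f'}(z)=2\left(\sum_{k=1}^{n+2}\frac{\beta_k}{z-z_k}-\frac1z\right),\qquad \sum_{k=1}^{n+2}\beta_k=1,$$ where the distinct points $z_k\in\partial\mathbb{D}$ are the pre-vertices and $2\pi\beta_k\neq0$ are the exterior angles of the polygon, $2\pi\beta_k=\pi-\alpha_k$, with $\alpha_k$ the interior angle of the polygon at the vertex $f(z_k)$. It is known that $zf''/f'$ always has the stated representation in terms of finite Blaschke products. A finite Blaschke product of degree $d$ is a function $c\prod_{k=1}^{d}\frac{z-a_k}{1-\overline{a_k}z}$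 with $|c|=1$ and all $|a_k|<1$ (a unimodular constant if $d=0$). *)

theory Defs
  imports "HOL-Complex_Analysis.Complex_Analysis"
begin

definition polygon_edge :: "nat \<Rightarrow> (nat \<Rightarrow> complex) \<Rightarrow> nat \<Rightarrow> complex set" where
  "polygon_edge N p k = closed_segment (p k) (p (Suc k mod N))"

text \<open>
  \<open>p 0, \<dots>, p (N - 1)\<close> are, in cyclic order, the vertices of a simple closed polygonal curve:
  two different edges meet at most in a common end point. Non-collinearity excludes the
  interior angle \<open>\<pi>\<close> (exterior angle 0), so that all the points \<open>p k\<close> are genuine vertices.
\<close>

definition polygon_vertices :: "nat \<Rightarrow> (nat \<Rightarrow> complex) \<Rightarrow> bool" where
  "polygon_vertices N p \<longleftrightarrow>
     3 \<le> N \<and> inj_on p {..<N} \<and>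
     (\<forall>i<N. \<forall>j<N. i \<noteq> j \<longrightarrow>
        polygon_edge N p i \<inter> polygon_edge N p j
          \<subseteq> {p i, p (Suc i mod N)} \<inter> {p j, p (Suc j mod N)}) \<and>
     (\<forall>k<N. \<not> collinear {p k, p (Suc k mod N), p (Suc (Suc k) mod N)})"

definition polygon_boundary :: "nat \<Rightarrow> (nat \<Rightarrow> complex) \<Rightarrow> complex set" where
  "polygon_boundary N p = (\<Union>k<N. polygon_edge N p k)"

definition is_polygon :: "nat \<Rightarrow> complex set \<Rightarrow> bool" where
  "is_polygon N P \<longleftrightarrow>
     (\<exists>p. polygon_vertices N p \<and> P = polygon_boundary N p \<union> inside (polygon_boundary N p))"

text \<open>
  A univalent meromorphic map of the unit disk onto the complement of an \<open>N\<close>-gon in the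
  Riemann sphere that takes the value \<open>\<infinity>\<close> at 0. By injectivity \<open>\<infinity>\<close> is taken only at 0, so the
  map is holomorphic on the punctured disk and maps it onto the complement in the finite
  plane; the value of \<open>f\<close> at the pole is irrelevant.
\<close>

definition schwarz_christoffel_exterior :: "nat \<Rightarrow> (complex \<Rightarrow> complex) \<Rightarrow> bool" where
  "schwarz_christoffel_exterior N f \<longleftrightarrow>
     f holomorphic_on (ball 0 1 - {0}) \<and> is_pole f 0 \<and> inj_on f (ball 0 1 - {0}) \<and>
     (\<exists>P. is_polygon N P \<and> f ` (ball 0 1 - {0}) = - P)"

text \<open>\<open>B\<close> agrees on the unit disk with a finite Blaschke product of degree \<open>d\<close>.\<close>

definition finite_blaschke :: "nat \<Rightarrow> (complex \<Rightarrow> complex) \<Rightarrow> bool" where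
  "finite_blaschke d B \<longleftrightarrow>
     (\<exists>c a. norm c = 1 \<and> (\<forall>k<d. norm (a k) < 1) \<and>
        (\<forall>z\<in>ball 0 1. B z = c * (\<Prod>k<d. (z - a k) / (1 - cnj (a k) * z))))"

text \<open>
  The identity \<open>z f''/f' = 2 / (z\<^sup>2 (B1/B2) - 1)\<close> of meromorphic functions on the unit disk,
  stated pointwise off the finitely many zeros of \<open>B2\<close>, where the quotient \<open>B1 z / B2 z\<close>
  would take the default value 0, and off the pole of \<open>f\<close>; at the excluded points it is
  determined by continuity.
\<close>

definition blaschke_representation ::
    "(complex \<Rightarrow> complex) \<Rightarrow> (complex \<Rightarrow> complex) \<Rightarrow> (complex \<Rightarrow> complex) \<Rightarrow> bool" where
  "blaschke_representation f B1 B2 \<longleftrightarrow>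
     (\<forall>z\<in>ball 0 1 - {0}. B2 z \<noteq> 0 \<longrightarrow>
        z * (deriv (deriv f) z / deriv f z) = 2 / (z\<^sup>2 * (B1 z / B2 z) - 1))"

end

theory Submission
  imports Defs
begin

text \<open>
  Put \<open>\<phi> = z\<^sup>2 B1 / B2\<close>. On the unit circle \<open>\<phi>\<close> is unimodular and \<open>v = z \<phi>' / \<phi>\<close> equals
  2 plus the Poisson kernels at the zeros of \<open>B1\<close> minus those at the zeros of \<open>B2\<close>; each of them
  lies between \<open>1 / R\<close> and \<open>R\<close> for \<open>R = (1 + r) / (1 - r)\<close>. The first bound fails only if \<open>v > -2\<close> on
  the whole circle, and the second one only if \<open>v < 0\<close> there.

  Injectivity of \<open>f\<close> makes its pole simple and \<open>f\<close> bounded near the circle, so \<open>h = z\<^sup>2 f'\<close>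
  is zero-free in the disk with \<open>\<bar>h\<bar> \<le> C / (1 - \<bar>z\<bar>)\<close>, and \<open>h' / h = 2 \<phi> / (z (\<phi> - 1))\<close> shows that
  \<open>\<phi> \<noteq> 1\<close> in the disk. Since \<open>\<phi>\<close> has a pole, the maximum principle gives points of the disk where
  \<open>\<phi> = l\<close>, for each \<open>l > 1\<close>. As \<open>l\<close> tends to 1 they accumulate at a point \<open>\<zeta>\<close> of the circle with
  \<open>\<phi>(\<zeta>) = 1\<close>, along a direction \<open>w\<close> pointing into the disk, in which \<open>\<phi> - 1 \<approx> \<bar>g(\<zeta>)\<bar> s ^ m\<close> with
  \<open>m\<close> the order of the zero of \<open>\<phi> - 1\<close>. If \<open>m \<ge> 2\<close>, or if \<open>m = 1\<close> and \<open>-2 < v(\<zeta>) < 0\<close>, then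
  \<open>\<bar>h\<bar>\<close> grows along that direction faster than \<open>1 / s\<close>, which is impossible. For the second bound
  the same crossing argument is applied to \<open>1 / \<phi>\<close>, which has a pole at 0; if \<open>v < 0\<close> throughout, the
  direction of approach would point out of the disk.
\<close>

section \<open>Finite Blaschke products on the unit circle\<close>

text \<open>\<open>finite_blaschke\<close> fixes a function only on the open disk. The explicit
  product, taken without its unimodular constant, is also available on the circle and beyond
  it.\<close>

definition blaschke_prod :: "nat \<Rightarrow> (nat \<Rightarrow> complex) \<Rightarrow> complex \<Rightarrow> complex" where
  "blaschke_prod d a z = (\<Prod>k<d. (z - a k) / (1 - cnj (a k) * z))"

lemma one_minus_cnj_mult_nonzero:
  fixes a z :: complex
  assumes "norm a < 1" "norm z \<le> 1"
  shows "1 - cnj a * z \<noteq> 0"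
proof
  assume "1 - cnj a * z = 0"
  then have "norm a * norm z = 1" by (metis complex_mod_cnj eq_iff_diff_eq_0 norm_mult norm_one)
  moreover have "norm a * norm z \<le> norm a" using assms by (simp add: mult_left_le)
  ultimately show False using assms by simp
qed

lemma one_minus_cnj_mult_circle:
  fixes a z :: complex
  assumes "norm z = 1"
  shows "1 - cnj a * z = z * cnj (z - a)"
proof -
  have "z * cnj z = 1" using assms by (simp add: complex_norm_square[symmetric])
  then show ?thesis by (simp add: algebra_simps)
qed

lemma norm_blaschke_prod_circle:
  assumes "\<forall>k<d. norm (a k) < 1" "norm z = 1"
  shows "norm (blaschke_prod d a z) = 1"
proof -
  have "norm ((z - a k) / (1 - cnj (a k) * z)) = 1" if "k < d" for k
  proof -
    have "z \<noteq> a k" using assms that by auto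
    then show ?thesis
      using assms(2) by (simp add: one_minus_cnj_mult_circle norm_divide norm_mult del: complex_cnj_diff)
  qed
  then show ?thesis by (simp add: blaschke_prod_def prod_norm[symmetric])
qed

text \<open>The derivative is written as \<open>q / z\<close> times a real number. That number is
  the logarithmic derivative \<open>z q' / q\<close>, the Poisson kernel of \<open>a\<close> at
  \<open>z\<close>, and in this form the contributions of the factors of a product simply
  add.\<close>

lemma blaschke_factor_has_field_derivative:
  fixes a z :: complex
  assumes "norm a < 1" "norm z = 1"
  defines "q \<equiv> (z - a) / (1 - cnj a * z)"
  shows "((\<lambda>w. (w - a) / (1 - cnj a * w)) has_field_derivative
           q / z * of_real ((1 - (norm a)\<^sup>2) / (norm (z - a))\<^sup>2)) (at z)"
proof -
  have za: "z \<noteq> a" "z \<noteq> 0" using assms by auto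
  have nz: "1 - cnj a * z \<noteq> 0" using assms by (intro one_minus_cnj_mult_nonzero) auto
  have e: "of_real ((1 - (norm a)\<^sup>2) / (norm (z - a))\<^sup>2)
        = (1 - a * cnj a) / ((z - a) * cnj (z - a))"
    unfolding of_real_divide of_real_diff of_real_1 complex_norm_square by simp
  have "((\<lambda>w. (w - a) / (1 - cnj a * w)) has_field_derivative
          (1 - a * cnj a) / (1 - cnj a * z)\<^sup>2) (at z)"
    using nz by (auto intro!: derivative_eq_intros simp: divide_simps power2_eq_square) (simp add: algebra_simps)
  also have "(1 - a * cnj a) / (1 - cnj a * z)\<^sup>2 = q / z * of_real ((1 - (norm a)\<^sup>2) / (norm (z - a))\<^sup>2)"
  proof -
    have "cnj (z - a) \<noteq> 0" using za by simp
    then show ?thesis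
      unfolding e q_def one_minus_cnj_mult_circle[OF assms(2)] using za
      by (simp add: divide_simps power2_eq_square del: complex_cnj_diff)
  qed
  finally show ?thesis .
qed

lemma blaschke_prod_has_field_derivative:
  assumes "\<forall>k<d. norm (a k) < 1" "norm z = 1"
  shows "(blaschke_prod d a has_field_derivative
           blaschke_prod d a z / z * of_real (\<Sum>k<d. (1 - (norm (a k))\<^sup>2) / (norm (z - a k))\<^sup>2)) (at z)"
  using assms(1)
proof (induction d)
  case 0
  then show ?case by (simp add: blaschke_prod_def)
next
  case (Suc d)
  have eq: "blaschke_prod (Suc d) a = (\<lambda>w. blaschke_prod d a w * ((w - a d) / (1 - cnj (a d) * w)))"
    by (simp add: blaschke_prod_def fun_eq_iff)
  have IH: "(blaschke_prod d a has_field_derivative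
           blaschke_prod d a z / z * of_real (\<Sum>k<d. (1 - (norm (a k))\<^sup>2) / (norm (z - a k))\<^sup>2)) (at z)"
    using Suc by simp
  have a: "norm (a d) < 1" using Suc.prems by simp
  show ?case
    unfolding eq
    by (rule DERIV_cong[OF DERIV_mult[OF IH blaschke_factor_has_field_derivative[OF a assms(2)]]])
       (simp add: algebra_simps)
qed

lemma blaschke_prod_holomorphic_on:
  "blaschke_prod d a holomorphic_on {z. \<forall>k<d. 1 - cnj (a k) * z \<noteq> 0}"
proof -
  have "blaschke_prod d a = (\<lambda>z. \<Prod>k<d. (z - a k) / (1 - cnj (a k) * z))"
    by (simp add: blaschke_prod_def fun_eq_iff)
  then show ?thesis by (auto intro!: holomorphic_intros)
qed

lemma blaschke_prod_eq_0_iff: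
  assumes "\<forall>k<d. norm (a k) < 1" "norm z \<le> 1"
  shows "blaschke_prod d a z = 0 \<longleftrightarrow> (\<exists>k<d. z = a k)"
  using assms one_minus_cnj_mult_nonzero by (auto simp: blaschke_prod_def)

text \<open>Since \<open>1 - norm a \<le> norm (z - a) \<le> 1 + norm a\<close>, the kernel lies
  between \<open>(1 - t) / (1 + t)\<close> and its reciprocal for \<open>t = norm a\<close>; both
  are monotone in \<open>t\<close>.\<close>

lemma poisson_kernel_bounds:
  fixes a z :: complex and r :: real
  assumes "norm a \<le> r" "r < 1" "norm z = 1"
  shows "(1 - r) / (1 + r) \<le> (1 - (norm a)\<^sup>2) / (norm (z - a))\<^sup>2"
    and "(1 - (norm a)\<^sup>2) / (norm (z - a))\<^sup>2 \<le> (1 + r) / (1 - r)"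
proof -
  let ?t = "norm a"
  have t: "0 \<le> ?t" "?t < 1" using assms by auto
  have r: "0 \<le> r" using t assms by linarith
  have pos: "1 + ?t \<noteq> 0" "1 - ?t \<noteq> 0" using t by linarith+
  have lo: "1 - ?t \<le> norm (z - a)" using norm_triangle_ineq2[of z a] assms by simp
  have hi: "norm (z - a) \<le> 1 + ?t" using norm_triangle_ineq4[of z a] assms by simp
  have eq: "1 - ?t\<^sup>2 = (1 - ?t) * (1 + ?t)" by (simp add: power2_eq_square algebra_simps)
  have "(1 - r) / (1 + r) \<le> (1 - ?t) / (1 + ?t)"
    using assms t r by (intro frac_le) linarith+
  also have "\<dots> = (1 - ?t\<^sup>2) / (1 + ?t)\<^sup>2"
    unfolding eq using t pos by (simp add: power2_eq_square)
  also have "\<dots> \<le> (1 - ?t\<^sup>2) / (norm (z - a))\<^sup>2"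
    using t lo hi by (intro divide_left_mono power_mono mult_pos_pos zero_less_power)
      (auto simp: eq)
  finally show "(1 - r) / (1 + r) \<le> (1 - ?t\<^sup>2) / (norm (z - a))\<^sup>2" .
  have "(1 - ?t\<^sup>2) / (norm (z - a))\<^sup>2 \<le> (1 - ?t\<^sup>2) / (1 - ?t)\<^sup>2"
    using t lo hi by (intro divide_left_mono power_mono mult_pos_pos zero_less_power)
      (auto simp: eq)
  also have "\<dots> = (1 + ?t) / (1 - ?t)"
    unfolding eq using t pos by (simp add: power2_eq_square)
  also have "\<dots> \<le> (1 + r) / (1 - r)"
    using assms t r by (intro frac_le) linarith+
  finally show "(1 - ?t\<^sup>2) / (norm (z - a))\<^sup>2 \<le> (1 + r) / (1 - r)" .
qed

text \<open>Where \<open>N\<close> and \<open>D\<close> agree the quotient is 1, so its derivative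
  is its logarithmic derivative, and the logarithmic derivatives of \<open>N\<close> and
  \<open>D\<close> subtract.\<close>

lemma logarithmic_derivative_quotient:
  fixes N D :: "'a::real_normed_field \<Rightarrow> 'a"
  assumes "(N has_field_derivative N z / z * s) (at z)" "(D has_field_derivative D z / z * t) (at z)"
    and "N z = D z" "D z \<noteq> 0" "z \<noteq> 0"
  shows "((\<lambda>w. N w / D w) has_field_derivative (s - t) / z) (at z)"
  by (rule DERIV_cong[OF DERIV_divide[OF assms(1,2,4)]]) (use assms in \<open>simp add: field_simps\<close>)

section \<open>Crossings of the value 1 by a quotient unimodular on the circle\<close>

text \<open>
  Circle and unit disk are mapped by \<open>w \<mapsto> (w + l) / (w - l)\<close> into the left half plane,
  whereas the value \<open>\<infinity>\<close> is mapped to 1.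
\<close>

lemma unimodular_quotient_attains:
  fixes N D :: "complex \<Rightarrow> complex" and l :: real
  assumes S: "open S" "cball 0 1 \<subseteq> S" and hol: "N holomorphic_on S" "D holomorphic_on S"
    and circle: "\<And>z. norm z = 1 \<Longrightarrow> norm (N z) = norm (D z) \<and> D z \<noteq> 0"
    and p: "p \<in> ball 0 1" "D p = 0" "N p \<noteq> 0" and l: "l > 1"
  obtains z where "z \<in> ball 0 1" "N z = of_real l * D z"
proof -
  have "\<exists>z\<in>ball 0 1. N z = of_real l * D z"
  proof (rule ccontr)
    assume no: "\<not> (\<exists>z\<in>ball 0 1. N z = of_real l * D z)"
    have nz: "N z - of_real l * D z \<noteq> 0" if "z \<in> cball 0 1" for z
    proof (cases "norm z = 1")
      case True
      show ?thesis
      proof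
        assume "N z - of_real l * D z = 0"
        then have "norm (N z) = l * norm (D z)" using l by (simp add: norm_mult)
        then show False using circle[OF True] l by simp
      qed
    next
      case False
      then show ?thesis using no that by auto
    qed
    define T where "T = (\<lambda>z. (N z + of_real l * D z) / (N z - of_real l * D z))"
    have holT: "T holomorphic_on cball 0 1"
      unfolding T_def using nz S by (auto intro!: holomorphic_intros intro: hol[THEN holomorphic_on_subset])
    have "Re (T p) \<le> 0"
    proof (rule maximum_real_frontier[where S = "cball 0 1" and f = T and B = 0])
      show "T holomorphic_on interior (cball 0 1)"
        using holT by (rule holomorphic_on_subset) auto
      show "continuous_on (closure (cball 0 1)) T"
        using holT by (simp add: holomorphic_on_imp_continuous_on)
      show "Re (T z) \<le> 0" if "z \<in> frontier (cball 0 1)" for z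
      proof -
        have z: "norm (N z) = norm (D z)" using that circle[of z] by simp
        \<comment> \<open>The real part of a quotient has the sign of the real part of numerator
          times conjugate denominator.\<close>
        have "Re ((N z + of_real l * D z) * cnj (N z - of_real l * D z)) =
              (norm (N z))\<^sup>2 - l\<^sup>2 * (norm (D z))\<^sup>2"
          unfolding cmod_power2 by (simp add: power2_eq_square algebra_simps)
        also have "\<dots> = (1 - l\<^sup>2) * (norm (D z))\<^sup>2" by (simp add: z algebra_simps)
        also have "\<dots> \<le> 0" using l by (intro mult_nonpos_nonneg) auto
        finally show ?thesis
          unfolding T_def Re_divide_numeral
          by (subst complex_div_cnj) (simp add: divide_nonpos_nonneg flip: of_real_power del: times_complex.simps complex_cnj_diff)
      qed
    qed (use p in auto)
    then show False using p by (simp add: T_def)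
  qed
  then show ?thesis using that by blast
qed

text \<open>Points where \<open>N / D\<close> takes real values above 1 that tend to 1 cannot
  accumulate inside the disk, where \<open>N\<close> and \<open>D\<close> differ; a subsequence
  reaches the circle along a limiting direction \<open>w\<close>. Here \<open>m\<close> is the order
  of the zero of \<open>N / D - 1\<close>, and the last conclusion says that
  \<open>N / D - 1\<close> is positive to leading order along \<open>w\<close>. Keeping
  \<open>N\<close> and \<open>D\<close> separate allows them to be exchanged later.\<close>

lemma unimodular_quotient_crossing:
  fixes N D :: "complex \<Rightarrow> complex"
  assumes S: "open S" "cball 0 1 \<subseteq> S" and hol: "N holomorphic_on S" "D holomorphic_on S"
    and circle: "\<And>z. norm z = 1 \<Longrightarrow> norm (N z) = norm (D z) \<and> D z \<noteq> 0"
    and neq: "\<And>z. z \<in> ball 0 1 \<Longrightarrow> N z \<noteq> D z"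
    and p: "p \<in> ball 0 1" "D p = 0"
  obtains \<zeta> w g m r where "norm \<zeta> = 1" "N \<zeta> = D \<zeta>" "norm w = 1" "Re (w * cnj \<zeta>) < 0"
    "0 < m" "0 < r" "g holomorphic_on ball \<zeta> r" "g \<zeta> \<noteq> 0"
    "\<And>z. z \<in> ball \<zeta> r \<Longrightarrow> D z \<noteq> 0 \<and> N z = D z * (1 + (z - \<zeta>) ^ m * g z)"
    "w ^ m * g \<zeta> = of_real (norm (g \<zeta>))"
proof -
  define l where "l n = 1 + 1 / real (Suc n)" for n
  have l: "l n > 1" for n by (simp add: l_def)
  have "l \<longlonglongrightarrow> 1 + 0" unfolding l_def by (intro tendsto_intros lim_inverse_n'[THEN LIMSEQ_Suc])
  then have l_lim: "l \<longlonglongrightarrow> 1" by simp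
  have Np: "N p \<noteq> 0" using neq[of p] p by auto
  have "\<exists>z. z \<in> ball 0 1 \<and> N z = of_real (l n) * D z" for n
    using unimodular_quotient_attains[OF S hol circle p Np l[of n]] by blast
  then obtain x where x: "\<And>n. x n \<in> ball 0 1" "\<And>n. N (x n) = of_real (l n) * D (x n)" by metis
  have contN: "continuous_on S N" and contD: "continuous_on S D"
    using hol by (auto intro: holomorphic_on_imp_continuous_on)
  have "\<forall>n. x n \<in> cball 0 1" using x(1) less_imp_le by auto
  then obtain \<zeta> r1 where r1: "\<zeta> \<in> cball 0 1" "strict_mono r1" "(x \<circ> r1) \<longlonglongrightarrow> \<zeta>"
    using compact_cball[of "0::complex" 1] unfolding compact_def by meson
  have \<zeta>S: "\<zeta> \<in> S" using r1 S by auto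
  have lim_comp: "(\<lambda>n. F (x (r1 n))) \<longlonglongrightarrow> F \<zeta>" if "continuous_on S F" for F :: "complex \<Rightarrow> complex"
  proof -
    have "isCont F \<zeta>" using that \<zeta>S S(1) continuous_on_eq_continuous_at by blast
    then show ?thesis using r1(3) isCont_tendsto_compose by (auto simp: o_def)
  qed
  have l1: "(\<lambda>n. l (r1 n)) \<longlonglongrightarrow> 1"
    using LIMSEQ_subseq_LIMSEQ[OF l_lim r1(2)] by (simp add: o_def)
  have "(\<lambda>n. of_real (l (r1 n)) * D (x (r1 n))) \<longlonglongrightarrow> of_real 1 * D \<zeta>"
    by (intro tendsto_intros l1 lim_comp contD)
  then have eq: "N \<zeta> = D \<zeta>"
    using lim_comp[OF contN] x(2) by (simp add: LIMSEQ_unique)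
  have \<zeta>: "norm \<zeta> = 1" using neq[of \<zeta>] eq r1(1) by force
  have xne: "x n \<noteq> \<zeta>" for n using x(1)[of n] \<zeta> by auto
  \<comment> \<open>Normalised directions of approach; compactness of the circle gives them a limit
    \<open>w\<close> along a further subsequence.\<close>
  define d where "d n = (x (r1 n) - \<zeta>) / of_real (norm (x (r1 n) - \<zeta>))" for n
  have "\<forall>n. d n \<in> sphere 0 1" using xne by (simp add: d_def norm_divide)
  then obtain w r2 where r2: "w \<in> sphere 0 1" "strict_mono r2" "(d \<circ> r2) \<longlonglongrightarrow> w"
    using compact_sphere[of "0::complex" 1] unfolding compact_def by meson
  have w: "norm w = 1" using r2(1) by simp
  define y where "y n = x (r1 (r2 n))" for n
  define t where "t n = norm (y n - \<zeta>)" for n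
  define e where "e n = d (r2 n)" for n
  define \<mu> where "\<mu> n = l (r1 (r2 n))" for n
  have e_lim: "e \<longlonglongrightarrow> w" using r2(3) by (simp add: e_def[abs_def] o_def)
  have t: "t n > 0" for n using xne by (simp add: t_def y_def)
  have y_eq: "y n = \<zeta> + of_real (t n) * e n" for n
    using t[of n] by (simp add: e_def d_def t_def y_def)
  have e1: "norm (e n) = 1" for n using xne by (simp add: e_def d_def norm_divide)
  have y_lim: "y \<longlonglongrightarrow> \<zeta>"
    using LIMSEQ_subseq_LIMSEQ[OF r1(3) r2(2)] by (simp add: y_def[abs_def] o_def)
  have y_in: "y n \<in> ball 0 1" for n using x(1) by (simp add: y_def)
  have Ny: "N (y n) = of_real (\<mu> n) * D (y n)" for n using x(2) by (simp add: y_def \<mu>_def)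
  have \<mu>: "\<mu> n > 1" for n using l by (simp add: \<mu>_def)

  define V where "V = {z \<in> S. D z \<noteq> 0}"
  have V: "open V" "\<zeta> \<in> V"
  proof -
    have "V = S \<inter> D -` (- {0})" by (auto simp: V_def)
    then show "open V" using continuous_open_preimage[OF contD S(1)] by (simp add: open_Compl)
    show "\<zeta> \<in> V" using \<zeta>S circle[OF \<zeta>] by (simp add: V_def)
  qed
  obtain r0 where r0: "r0 > 0" "ball \<zeta> r0 \<subseteq> V" using V by (meson openE)
  define F where "F = (\<lambda>z. N z / D z - 1)"
  have holF: "F holomorphic_on ball \<zeta> r0"
    unfolding F_def using r0(2) by (intro holomorphic_intros holomorphic_on_subset[OF hol(1)] holomorphic_on_subset[OF hol(2)]) (auto simp: V_def)
  have F\<zeta>: "F \<zeta> = 0" using eq circle[OF \<zeta>] by (simp add: F_def)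
  have Fy: "F (y n) = of_real (\<mu> n - 1)" if "y n \<in> ball \<zeta> r0" for n
  proof -
    have "D (y n) \<noteq> 0" using that r0(2) by (auto simp: V_def)
    then show ?thesis by (simp add: F_def Ny)
  qed
  have near: "eventually (\<lambda>n. y n \<in> ball \<zeta> s) sequentially" if "s > 0" for s
    using topological_tendstoD[OF y_lim, of "ball \<zeta> s"] that by simp
  \<comment> \<open>If constant, \<open>F\<close> would vanish near \<zeta>, but
    \<open>F (y n) = \<mu> n - 1 > 0\<close> for large \<open>n\<close>.\<close>
  have nconst: "\<not> F constant_on ball \<zeta> r0"
  proof
    assume "F constant_on ball \<zeta> r0"
    then have F0: "F z = 0" if "z \<in> ball \<zeta> r0" for z
      using that F\<zeta> r0(1) unfolding constant_on_def by (metis centre_in_ball)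
    obtain n where n: "y n \<in> ball \<zeta> r0"
      using eventually_happens'[OF sequentially_bot near[OF r0(1)]] by blast
    show False using F0[OF n] Fy[OF n] \<mu>[of n] by simp
  qed
  obtain g r m where m: "0 < m" and r: "0 < r" "ball \<zeta> r \<subseteq> ball \<zeta> r0"
    and g: "g holomorphic_on ball \<zeta> r" "\<And>z. z \<in> ball \<zeta> r \<Longrightarrow> F z = (z - \<zeta>) ^ m * g z"
      "\<And>z. z \<in> ball \<zeta> r \<Longrightarrow> g z \<noteq> 0"
    using holomorphic_factor_zero_nonconstant[OF holF _ _ _ F\<zeta> nconst] r0(1)
    by (metis centre_in_ball connected_ball open_ball)
  have g_cont: "isCont g \<zeta>"
    using g(1) r by (meson centre_in_ball continuous_on_eq_continuous_at holomorphic_on_imp_continuous_on open_ball)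
  have g_lim: "(\<lambda>n. g (y n)) \<longlonglongrightarrow> g \<zeta>" using isCont_tendsto_compose[OF g_cont y_lim] .
  \<comment> \<open>Both \<open>t n ^ m\<close> and \<open>F (y n)\<close> are positive reals, so
    \<open>e n ^ m * g (y n)\<close> is positive and equals its modulus, which is that of
    \<open>g (y n)\<close>.\<close>
  have "eventually (\<lambda>n. e n ^ m * g (y n) = of_real (norm (g (y n)))) sequentially"
    using near[OF r(1)]
  proof eventually_elim
    case (elim n)
    let ?q = "(\<mu> n - 1) / t n ^ m"
    have "of_real (t n) ^ m * (e n ^ m * g (y n)) = of_real (\<mu> n - 1)"
      using g(2)[OF elim] Fy[of n] r(2) elim by (auto simp: y_eq power_mult_distrib algebra_simps)
    then have q: "e n ^ m * g (y n) = of_real ?q"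
      using t[of n] by (simp add: field_simps)
    then have "norm (e n ^ m * g (y n)) = ?q"
      using \<mu>[of n] t[of n] by (simp only: norm_of_real) (simp add: divide_nonneg_nonneg)
    then have "norm (g (y n)) = ?q" using e1[of n] by (simp add: norm_mult norm_power)
    then show ?case using q by simp
  qed
  moreover have "(\<lambda>n. e n ^ m * g (y n)) \<longlonglongrightarrow> w ^ m * g \<zeta>"
    by (intro tendsto_intros e_lim g_lim)
  ultimately have "(\<lambda>n. of_real (norm (g (y n)))) \<longlonglongrightarrow> w ^ m * g \<zeta>"
    using Lim_transform_eventually by fast
  moreover have "(\<lambda>n. complex_of_real (norm (g (y n)))) \<longlonglongrightarrow> of_real (norm (g \<zeta>))"
    by (intro tendsto_intros g_lim)
  ultimately have wg: "w ^ m * g \<zeta> = of_real (norm (g \<zeta>))"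
    by (rule LIMSEQ_unique)

  have "Re (w * cnj \<zeta>) \<le> 0"
  proof (rule LIMSEQ_le_const2)
    show "(\<lambda>n. Re (e n * cnj \<zeta>)) \<longlonglongrightarrow> Re (w * cnj \<zeta>)"
      by (intro tendsto_intros e_lim)
    show "\<exists>M. \<forall>n\<ge>M. Re (e n * cnj \<zeta>) \<le> 0"
    proof (intro exI allI impI)
      fix n
      have "(norm (y n))\<^sup>2 = (norm \<zeta>)\<^sup>2 + (t n)\<^sup>2 * (norm (e n))\<^sup>2 + 2 * t n * Re (e n * cnj \<zeta>)"
        unfolding y_eq cmod_power2 by (simp add: power2_eq_square algebra_simps)
      moreover have "(norm (y n))\<^sup>2 < 1" using y_in[of n] by (simp add: power_less_one_iff)
      ultimately have "2 * t n * Re (e n * cnj \<zeta>) + (t n)\<^sup>2 < 0"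
        using \<zeta> e1[of n] by (simp del: times_complex.simps)
      then have "2 * t n * Re (e n * cnj \<zeta>) < 0" using zero_le_power2[of "t n"] by linarith
      then show "Re (e n * cnj \<zeta>) \<le> 0"
        using t[of n] by (simp add: mult_less_0_iff del: times_complex.simps)
    qed
  qed
  moreover have "Re (w * cnj \<zeta>) \<noteq> 0"
  proof
    \<comment> \<open>A tangential direction would make \<open>N / D\<close> leave the unit circle along the unit circle.\<close>
    assume 0: "Re (w * cnj \<zeta>) = 0"
    define \<tau> where "\<tau> = Im (w * cnj \<zeta>)"
    have "w * cnj \<zeta> = \<i> * of_real \<tau>" using 0 by (simp add: complex_eq_iff \<tau>_def)
    moreover have "\<zeta> * cnj \<zeta> = 1" using \<zeta> by (simp add: complex_norm_square[symmetric])
    ultimately have w_eq: "w = \<i> * of_real \<tau> * \<zeta>"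
      by (metis mult.assoc mult.commute mult.right_neutral)
    \<comment> \<open>For real \<open>s\<close> this curve runs on the circle; it starts at \<zeta>
      with derivative \<open>w\<close>. The complex parameter allows differentiation over the
      complex field.\<close>
    define c where "c = (\<lambda>s::complex. \<zeta> * exp (\<i> * of_real \<tau> * s))"
    have "(c has_field_derivative w) (at 0)"
      unfolding c_def w_eq by (auto intro!: derivative_eq_intros)
    then have c_lim: "((\<lambda>s. (c s - \<zeta>) / s) \<longlongrightarrow> w) (at 0)"
      by (simp add: has_field_derivative_iff c_def)
    have c_cont: "(c \<longlongrightarrow> \<zeta>) (at 0)"
      unfolding c_def by (auto intro!: tendsto_eq_intros)
    have of_real_lim: "filterlim complex_of_real (at 0) (at_right 0)"
      by (auto simp: filterlim_at eventually_at_filter intro!: tendsto_eq_intros)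
    define b where "b s = c (of_real s)" for s :: real
    have b1: "((\<lambda>s. (b s - \<zeta>) / of_real s) \<longlongrightarrow> w) (at_right 0)"
      using filterlim_compose[OF c_lim of_real_lim] by (simp add: b_def)
    have b2: "(b \<longlongrightarrow> \<zeta>) (at_right 0)"
      using filterlim_compose[OF c_cont of_real_lim] by (simp add: b_def[abs_def])
    have b_circle: "norm (b s) = 1" for s
      using \<zeta> by (simp add: b_def c_def norm_mult)
    have "((\<lambda>s. Re (((b s - \<zeta>) / of_real s) ^ m * g (b s))) \<longlongrightarrow> Re (w ^ m * g \<zeta>)) (at_right 0)"
      by (intro tendsto_intros b1 isCont_tendsto_compose[OF g_cont b2])
    moreover have "eventually (\<lambda>s. Re (((b s - \<zeta>) / of_real s) ^ m * g (b s)) \<le> 0) (at_right 0)"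
    proof -
      have "eventually (\<lambda>s. b s \<in> ball \<zeta> r) (at_right 0)"
        using topological_tendstoD[OF b2, of "ball \<zeta> r"] r by simp
      moreover have "eventually (\<lambda>s::real. s > 0) (at_right 0)"
        by (simp add: eventually_at_right_less)
      ultimately show ?thesis
      proof eventually_elim
        case (elim s)
        have "F (b s) + 1 = N (b s) / D (b s)" by (simp add: F_def)
        then have "norm (F (b s) + 1) = 1" using circle[OF b_circle] by (simp add: norm_divide)
        then have "Re (F (b s)) \<le> 0" using complex_Re_le_cmod[of "F (b s) + 1"] by simp
        moreover have "((b s - \<zeta>) / of_real s) ^ m * g (b s) = F (b s) / of_real (s ^ m)"
          using g(2)[OF elim(1)] by (simp add: power_divide)
        ultimately show ?case using elim(2) by (simp add: divide_nonpos_pos del: of_real_power)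
      qed
    qed
    ultimately have "Re (w ^ m * g \<zeta>) \<le> 0"
      by (rule tendsto_upperbound) simp
    then show False using wg g(3)[of \<zeta>] r by simp
  qed
  ultimately have "Re (w * cnj \<zeta>) < 0" by simp
  moreover have "D z \<noteq> 0 \<and> N z = D z * (1 + (z - \<zeta>) ^ m * g z)" if "z \<in> ball \<zeta> r" for z
  proof -
    have "D z \<noteq> 0" using that r(2) r0(2) by (auto simp: V_def)
    then show ?thesis using g(2)[OF that] by (simp add: F_def field_simps)
  qed
  ultimately show ?thesis using that[OF \<zeta> eq w _ m r(1) g(1) _ _ wg] g(3)[of \<zeta>] r by auto
qed

text \<open>The derivative of \<open>1 + (z - \<zeta>) ^ m * g z\<close> at \<zeta> is compared with
  \<open>v / \<zeta>\<close>. It vanishes for \<open>m \<ge> 2\<close>. For \<open>m = 1\<close> it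
  gives \<open>g \<zeta> = v / \<zeta>\<close>, and then \<open>wg\<close> turns into a relation
  between \<open>w\<close> and the radial direction.\<close>

lemma crossing_first_order:
  fixes N D g :: "complex \<Rightarrow> complex" and v :: real
  assumes \<zeta>: "norm \<zeta> = 1" and m: "0 < m" and r: "0 < r" and g: "g holomorphic_on ball \<zeta> r"
    and factor: "\<And>z. z \<in> ball \<zeta> r \<Longrightarrow> D z \<noteq> 0 \<and> N z = D z * (1 + (z - \<zeta>) ^ m * g z)"
    and wg: "w ^ m * g \<zeta> = of_real (norm (g \<zeta>))"
    and deriv: "((\<lambda>z. N z / D z) has_field_derivative of_real v / \<zeta>) (at \<zeta>)"
  shows "m \<noteq> 1 \<Longrightarrow> v = 0" and "m = 1 \<Longrightarrow> norm (g \<zeta>) = \<bar>v\<bar>"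
    and "m = 1 \<Longrightarrow> Re (w * cnj \<zeta>) * v = \<bar>v\<bar>"
proof -
  have "(g has_field_derivative deriv g \<zeta>) (at \<zeta>)"
    using r by (intro holomorphic_derivI[OF g]) auto
  then have "((\<lambda>z. 1 + (z - \<zeta>) ^ m * g z) has_field_derivative of_nat m * 0 ^ (m - 1) * g \<zeta>) (at \<zeta>)"
    using m by (auto intro!: derivative_eq_intros)
  moreover have "((\<lambda>z. 1 + (z - \<zeta>) ^ m * g z) has_field_derivative of_real v / \<zeta>) (at \<zeta>)"
    by (rule has_field_derivative_transform_within_open[OF deriv, of "ball \<zeta> r"])
       (use r factor in auto)
  ultimately have eq: "of_nat m * 0 ^ (m - 1) * g \<zeta> = of_real v / \<zeta>" by (rule DERIV_unique)
  have \<zeta>0: "\<zeta> \<noteq> 0" using \<zeta> by auto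
  show "v = 0" if "m \<noteq> 1" using eq that m \<zeta>0 by (auto simp: power_0_left)
  assume m1: "m = 1"
  then have g\<zeta>: "g \<zeta> = of_real v / \<zeta>" using eq by simp
  then show n: "norm (g \<zeta>) = \<bar>v\<bar>" using \<zeta> by (simp add: norm_divide)
  have "\<zeta> * cnj \<zeta> = 1" using \<zeta> by (simp add: complex_norm_square[symmetric])
  then have "cnj \<zeta> = 1 / \<zeta>" using \<zeta>0 by (simp add: field_simps)
  then have "w * cnj \<zeta> * of_real v = w ^ m * g \<zeta>" by (simp add: m1 g\<zeta>)
  also have "\<dots> = of_real \<bar>v\<bar>" unfolding wg n ..
  finally have "w * cnj \<zeta> * of_real v = of_real \<bar>v\<bar>" .
  then have "Re (w * cnj \<zeta> * of_real v) = \<bar>v\<bar>" by (simp only: Re_complex_of_real)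
  then show "Re (w * cnj \<zeta>) * v = \<bar>v\<bar>" by (simp add: algebra_simps)
qed

section \<open>The regularized derivative of the exterior map\<close>

text \<open>Identity theorem in the form of a cancellation rule: the zeros of \<open>f\<close> are
  isolated, so \<open>g\<close> vanishes near \<open>z\<close> off \<open>z\<close> itself, and at
  \<open>z\<close> by continuity.\<close>

lemma holomorphic_mult_eq_0:
  assumes "f holomorphic_on S" "g holomorphic_on S" "open S" "connected S"
    and "\<And>z. z \<in> S \<Longrightarrow> f z * g z = 0" and "p \<in> S" "f p \<noteq> 0" and "z \<in> S"
  shows "g z = 0"
proof -
  have "eventually (\<lambda>w. f w \<noteq> 0 \<and> w \<in> S) (at z)"
    using assms by (intro non_zero_neighbour_alt[of f S z p]) auto
  then have "eventually (\<lambda>w. g w = 0) (at z)"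
    by eventually_elim (use assms(5) in auto)
  moreover have "isCont g z"
    using continuous_on_eq_continuous_at[OF \<open>open S\<close>] holomorphic_on_imp_continuous_on[OF assms(2)] assms(8) by blast
  ultimately have "(\<lambda>_. 0) \<midarrow>z\<rightarrow> g z"
    unfolding isCont_def by (rule Lim_transform_eventually[rotated])
  then show ?thesis by (rule LIM_const_eq[symmetric])
qed

text \<open>Near 0 the reciprocal of \<open>f\<close> extends to a univalent function vanishing at
  0. Univalence makes this zero simple, so \<open>z * f z\<close> extends with a nonzero value, and
  it keeps \<open>f\<close> bounded away from 0.\<close>

lemma exterior_map_times_id:
  fixes f :: "complex \<Rightarrow> complex"
  assumes holf: "f holomorphic_on (ball 0 1 - {0})" and pole: "is_pole f 0"
    and inj: "inj_on f (ball 0 1 - {0})"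
  obtains g M where "g holomorphic_on ball 0 1" "g 0 \<noteq> 0"
    "\<And>z. z \<in> ball 0 1 - {0} \<Longrightarrow> g z = z * f z"
    "\<And>z. z \<in> ball 0 1 \<Longrightarrow> norm (g z) \<le> M"
proof -
  obtain U where U: "open U" "0 \<in> U" "\<And>y. y \<in> U \<Longrightarrow> y \<noteq> 0 \<Longrightarrow> norm (f y) \<ge> 1"
    using pole unfolding is_pole_alt by (meson zero_less_one)
  obtain e0 where e0: "e0 > 0" "ball 0 e0 \<subseteq> U" using U by (meson openE)
  define e where "e = min e0 (1/2)"
  have e: "e > 0" "e \<le> 1/2" "ball 0 e \<subseteq> U" using e0 by (auto simp: e_def)
  have sub: "ball 0 e \<subseteq> ball (0::complex) 1" "cball 0 e \<subseteq> ball (0::complex) 1" using e by auto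
  have fnz: "f y \<noteq> 0" if "y \<in> ball 0 e" "y \<noteq> 0" for y
    using U(3)[of y] that e(3) by auto
  define F where "F = (\<lambda>z. if z = 0 then 0 else inverse (f z))"
  have holF: "F holomorphic_on ball 0 e"
    unfolding F_def using fnz sub
    by (intro is_pole_inverse_holomorphic pole holomorphic_on_subset[OF holf]) auto
  have injF: "inj_on F (ball 0 e)"
  proof (rule inj_onI)
    fix x y assume xy: "x \<in> ball 0 e" "y \<in> ball 0 e" "F x = F y"
    then have "x \<in> ball 0 1" "y \<in> ball 0 1" using sub(1) by blast+
    then show "x = y" using xy fnz[of x] fnz[of y] inj_onD[OF inj, of x y]
      by (auto simp: F_def split: if_splits)
  qed
  define c where "c = deriv F 0"
  have c: "c \<noteq> 0" unfolding c_def
    using e by (intro holomorphic_injective_imp_regular[OF holF _ injF]) auto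
  define g where "g = (\<lambda>z. if z = 0 then 1 / c else z * f z)"
  have "(F has_field_derivative c) (at 0)"
    unfolding c_def using e by (intro holomorphic_derivI[OF holF]) auto
  then have "((\<lambda>z. F z / z) \<longlongrightarrow> c) (at 0)"
    by (simp add: has_field_derivative_iff F_def)
  then have "((\<lambda>z. inverse (F z / z)) \<longlongrightarrow> inverse c) (at 0)"
    using c by (intro tendsto_inverse)
  moreover have "eventually (\<lambda>z. inverse (F z / z) = g z) (at 0)"
  proof -
    \<comment> \<open>Valid for \<open>b = 0\<close> too, by the default values of division, so
      possible zeros of \<open>f\<close> need no separate treatment.\<close>
    have "a / inverse b = a * b" for a b :: complex by (cases "b = 0") (simp_all add: field_simps)
    then show ?thesis
      unfolding eventually_at_filter by (intro always_eventually) (simp add: F_def g_def)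
  qed
  ultimately have "(g \<longlongrightarrow> inverse c) (at 0)"
    by (rule Lim_transform_eventually)
  moreover have g0: "g 0 = inverse c" by (simp add: g_def inverse_eq_divide)
  ultimately have lim: "(g \<longlongrightarrow> g 0) (at 0 within ball 0 1)"
    by (auto intro: tendsto_within_subset[of _ _ _ UNIV])
  have "(\<lambda>z. z * f z) holomorphic_on (ball 0 1 - {0})" by (intro holomorphic_intros holf)
  then have "g holomorphic_on (ball 0 1 - {0})"
    by (rule holomorphic_transform) (auto simp: g_def)
  then have holg: "g holomorphic_on ball 0 1"
  proof (rule no_isolated_singularity'[rotated])
    show "(g \<longlongrightarrow> g z) (at z within ball 0 1)" if "z \<in> {0}" for z
      using that lim by simp
  qed auto
  \<comment> \<open>By the open mapping theorem all large values of \<open>f\<close> are attained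
    near 0, so injectivity bounds \<open>f\<close> by \<open>1 / d\<close> elsewhere.\<close>
  have "open (F ` ball 0 e)"
    using holF injF by (intro open_mapping_thm3) auto
  moreover have "0 \<in> F ` ball 0 e" using e by (auto simp: F_def intro!: image_eqI[of _ _ 0])
  ultimately obtain d where d: "d > 0" "ball 0 d \<subseteq> F ` ball 0 e" by (meson openE)
  have far: "norm (f z) \<le> 1 / d" if z: "z \<in> ball 0 1" "z \<notin> ball 0 e" for z
  proof (rule ccontr)
    assume a: "\<not> norm (f z) \<le> 1 / d"
    then have fz: "norm (f z) > 1 / d" "f z \<noteq> 0" using d by auto
    then have "norm (inverse (f z)) < d"
      using d by (simp add: norm_inverse inverse_eq_divide norm_divide divide_less_eq mult.commute)
    then obtain y where y: "y \<in> ball 0 e" "F y = inverse (f z)" using d(2) by force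
    then have "y \<noteq> 0" "f y = f z" using fz by (auto simp: F_def split: if_splits)
    moreover have "z \<noteq> 0" using z e by auto
    ultimately have "y = z" using inj_onD[OF inj, of y z] y z sub by auto
    then show False using y z by simp
  qed
  have "compact (g ` cball 0 e)"
    using holg sub by (intro compact_continuous_image holomorphic_on_imp_continuous_on) (auto intro: holomorphic_on_subset)
  then obtain M0 where M0: "\<And>z. z \<in> cball 0 e \<Longrightarrow> norm (g z) \<le> M0"
    by (metis bounded_iff compact_imp_bounded imageI)
  show ?thesis
  proof (rule that[OF holg])
    show "g 0 \<noteq> 0" using c by (simp add: g_def)
    show "g z = z * f z" if "z \<in> ball 0 1 - {0}" for z using that by (simp add: g_def)
    show "norm (g z) \<le> max M0 (1 / d)" if "z \<in> ball 0 1" for z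
    proof (cases "z \<in> ball 0 e")
      case True
      then show ?thesis using M0[of z] by auto
    next
      case False
      then have "norm (g z) = norm z * norm (f z)" using e by (auto simp: g_def norm_mult)
      also have "\<dots> \<le> 1 * (1 / d)"
        using far[OF that False] that by (intro mult_mono) auto
      finally show ?thesis by simp
    qed
  qed
qed

text \<open>With \<open>g\<close> the extension of \<open>z * f z\<close>, the function
  \<open>h = z * g' - g\<close> extends \<open>z^2 * f'\<close> across 0, and
  \<open>h' = z * g''\<close>; thus \<open>k\<close> is \<open>g''\<close>. The growth bound is
  Cauchy's estimate for the bounded function \<open>g\<close>.\<close>

lemma exterior_map_derivatives:
  fixes f :: "complex \<Rightarrow> complex"
  assumes holf: "f holomorphic_on (ball 0 1 - {0})" and pole: "is_pole f 0"
    and inj: "inj_on f (ball 0 1 - {0})"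
  obtains h k C where "h holomorphic_on ball 0 1" "k holomorphic_on ball 0 1"
    "\<And>z. z \<in> ball 0 1 \<Longrightarrow> h z \<noteq> 0"
    "\<And>z. z \<in> ball 0 1 \<Longrightarrow> deriv h z = z * k z"
    "\<And>z. z \<in> ball 0 1 - {0} \<Longrightarrow>
        z * (deriv (deriv f) z / deriv f z) = (z\<^sup>2 * k z - 2 * h z) / h z"
    "\<And>z. z \<in> ball 0 1 \<Longrightarrow> norm (h z) \<le> C / (1 - norm z)"
proof -
  obtain g M where g: "g holomorphic_on ball 0 1" "g 0 \<noteq> 0"
    "\<And>z. z \<in> ball 0 1 - {0} \<Longrightarrow> g z = z * f z"
    "\<And>z. z \<in> ball 0 1 \<Longrightarrow> norm (g z) \<le> M"
    using exterior_map_times_id[OF assms] by metis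
  define h where "h = (\<lambda>z. z * deriv g z - g z)"
  define k where "k = deriv (deriv g)"
  let ?P = "ball 0 1 - {0} :: complex set"
  have P: "open ?P" by auto
  have holh: "h holomorphic_on ball 0 1" unfolding h_def
    by (intro holomorphic_intros g holomorphic_deriv) auto
  have holk: "k holomorphic_on ball 0 1" unfolding k_def
    by (intro holomorphic_deriv g) auto
  have dg: "(g has_field_derivative deriv g z) (at z)" if "z \<in> ball 0 1" for z
    using that g by (simp add: holomorphic_derivI)
  have dg': "(deriv g has_field_derivative k z) (at z)" if "z \<in> ball 0 1" for z
    unfolding k_def using that g by (intro holomorphic_derivI[of _ "ball 0 1"] holomorphic_deriv) auto
  have dh: "(h has_field_derivative z * k z) (at z)" if "z \<in> ball 0 1" for z
    unfolding h_def using dg[OF that] dg'[OF that] by (auto intro!: derivative_eq_intros)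
  have df: "deriv f z = h z / z\<^sup>2" if z: "z \<in> ?P" for z
  proof -
    have "((\<lambda>w. g w / w) has_field_derivative h z / z\<^sup>2) (at z)"
      unfolding h_def using z dg[of z]
      by (auto intro!: derivative_eq_intros simp: power2_eq_square algebra_simps)
    then have "(f has_field_derivative h z / z\<^sup>2) (at z)"
      by (rule has_field_derivative_transform_within_open[OF _ P z]) (use g in auto)
    then show ?thesis by (rule DERIV_imp_deriv)
  qed
  have ddf: "deriv (deriv f) z = (z\<^sup>2 * k z - 2 * h z) / z ^ 3" if z: "z \<in> ?P" for z
  proof -
    have "((\<lambda>w. h w / w\<^sup>2) has_field_derivative (z\<^sup>2 * k z - 2 * h z) / z ^ 3) (at z)"
      using z dh[of z]
      by (auto intro!: derivative_eq_intros simp: divide_simps power2_eq_square power3_eq_cube) (simp add: algebra_simps)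
    then have "(deriv f has_field_derivative (z\<^sup>2 * k z - 2 * h z) / z ^ 3) (at z)"
      by (rule has_field_derivative_transform_within_open[OF _ P z]) (use df in auto)
    then show ?thesis by (rule DERIV_imp_deriv)
  qed
  \<comment> \<open>At 0 the value is \<open>- g 0\<close>, nonzero because the pole is simple;
    elsewhere a univalent function has nonvanishing derivative.\<close>
  have nz: "h z \<noteq> 0" if "z \<in> ball 0 1" for z
  proof (cases "z = 0")
    case True
    then show ?thesis using g by (simp add: h_def)
  next
    case False
    then have "deriv f z \<noteq> 0"
      using that by (intro holomorphic_injective_imp_regular[OF holf P inj]) auto
    then show ?thesis using df[of z] that False by auto
  qed
  show ?thesis
  proof (rule that[OF holh holk nz])
    show "deriv h z = z * k z" if "z \<in> ball 0 1" for z
      using dh[OF that] by (rule DERIV_imp_deriv)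
    show "z * (deriv (deriv f) z / deriv f z) = (z\<^sup>2 * k z - 2 * h z) / h z" if "z \<in> ?P" for z
      proof -
      have "z \<noteq> 0" "h z \<noteq> 0" using that nz by auto
      then show ?thesis
        unfolding df[OF that] ddf[OF that] by (simp add: power2_eq_square power3_eq_cube)
    qed
    show "norm (h z) \<le> 3 * M / (1 - norm z)" if z: "z \<in> ball 0 1" for z
    proof -
      \<comment> \<open>Half the distance to the circle, as radius for Cauchy's estimate:
        \<open>2 * M / (1 - norm z)\<close> for \<open>deriv g z\<close>, plus \<open>M\<close> for
        \<open>g z\<close>, gives the constant \<open>3 * M\<close>.\<close>
      define \<rho> where "\<rho> = (1 - norm z) / 2"
      have \<rho>: "\<rho> > 0" using z by (simp add: \<rho>_def)
      have sub: "cball z \<rho> \<subseteq> ball 0 1"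
      proof
        fix y assume "y \<in> cball z \<rho>"
        then have "norm y \<le> norm z + \<rho>"
          using norm_triangle_ineq2[of y z] by (simp add: dist_norm norm_minus_commute)
        also have "\<dots> < 1" using z by (simp add: \<rho>_def field_simps)
        finally show "y \<in> ball 0 1" by simp
      qed
      have "norm ((deriv ^^ 1) g z) \<le> fact 1 * M / \<rho> ^ 1"
      proof (rule Cauchy_inequality)
        show "g holomorphic_on ball z \<rho>" "continuous_on (cball z \<rho>) g"
          using sub ball_subset_cball[of z \<rho>]
          by (auto intro!: holomorphic_on_imp_continuous_on holomorphic_on_subset[OF g(1)])
        show "norm (g x) \<le> M" if "norm (z - x) = \<rho>" for x
          using that sub by (intro g(4)) (auto simp: dist_norm)
      qed (rule \<rho>)
      then have dgz: "norm (deriv g z) \<le> M / \<rho>" by simp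
      have M: "0 \<le> M" using order_trans[OF norm_ge_zero g(4)[of 0]] by simp
      have "norm (h z) \<le> norm z * norm (deriv g z) + norm (g z)"
        unfolding h_def by (metis norm_mult norm_triangle_ineq4)
      also have "\<dots> \<le> 1 * (M / \<rho>) + M"
        using z dgz g(4)[OF z] M by (intro add_mono mult_mono) auto
      also have "\<dots> \<le> 3 * M / (1 - norm z)"
      proof -
        have "M \<le> M / (1 - norm z)" using z M by (simp add: pos_le_divide_eq mult_left_le)
        moreover have "M / \<rho> = 2 * (M / (1 - norm z))" "3 * M / (1 - norm z) = 3 * (M / (1 - norm z))"
          by (simp_all add: \<rho>_def)
        ultimately show ?thesis by linarith
      qed
      finally show ?thesis .
    qed
  qed
qed

text \<open>
  Where \<open>z\<^sup>2 * b1 z = b2 z\<close> the right-hand side of \<open>rep\<close> is the junk value \<open>2 / 0 = 0\<close>,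
  so the differential equation has to be extended to these points by the identity theorem.
\<close>

lemma blaschke_ode:
  fixes b1 b2 h k :: "complex \<Rightarrow> complex"
  assumes hol: "h holomorphic_on ball 0 1" "k holomorphic_on ball 0 1"
      "b1 holomorphic_on ball 0 1" "b2 holomorphic_on ball 0 1"
    and nz: "\<And>z. z \<in> ball 0 1 \<Longrightarrow> h z \<noteq> 0"
    and ncz: "\<And>z. \<lbrakk>z \<in> ball 0 1; b1 z = 0; b2 z = 0\<rbrakk> \<Longrightarrow> False"
    and p: "p \<in> ball 0 1" "b2 p \<noteq> 0"
    and rep: "\<And>z. \<lbrakk>z \<in> ball 0 1 - {0}; b2 z \<noteq> 0\<rbrakk> \<Longrightarrow>
        (z\<^sup>2 * k z - 2 * h z) / h z = 2 / (z\<^sup>2 * (b1 z / b2 z) - 1)"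
    and z: "z \<in> ball 0 1"
  shows "k z * (z\<^sup>2 * b1 z - b2 z) = 2 * h z * b1 z"
    and "z\<^sup>2 * b1 z - b2 z \<noteq> 0"
proof -
  let ?D = "ball 0 1 :: complex set"
  define E where "E = (\<lambda>z. z\<^sup>2 * b1 z - b2 z)"
  have holE: "E holomorphic_on ?D" unfolding E_def by (intro holomorphic_intros hol)
  have D: "open ?D" "connected ?D" by auto
  note cancel = holomorphic_mult_eq_0[OF _ _ D]
  \<comment> \<open>Were \<open>E\<close> identically 0, every right-hand side of \<open>rep\<close>
    would be the default value 0, so \<open>y^2 * k y = 2 * h y\<close> throughout, which
    contradicts \<open>h 0 \<noteq> 0\<close>.\<close>
  have "\<exists>q\<in>?D. E q \<noteq> 0"
  proof (rule ccontr)
    assume "\<not> (\<exists>q\<in>?D. E q \<noteq> 0)"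
    then have E0: "E q = 0" if "q \<in> ?D" for q using that by blast
    have "b2 y * (y * (y\<^sup>2 * k y - 2 * h y)) = 0" if y: "y \<in> ?D" for y
    proof (cases "y = 0 \<or> b2 y = 0")
      case False
      then have "y\<^sup>2 * (b1 y / b2 y) - 1 = 0" using E0[OF y] by (simp add: E_def field_simps)
      then have "(y\<^sup>2 * k y - 2 * h y) / h y = 0" using rep[of y] False y by simp
      then show ?thesis using nz[OF y] by simp
    qed auto
    then have 1: "y * (y\<^sup>2 * k y - 2 * h y) = 0" if "y \<in> ?D" for y
      using that p by (intro cancel[where f = b2 and p = p and g = "\<lambda>y. y * (y\<^sup>2 * k y - 2 * h y)"])
        (auto intro!: holomorphic_intros hol simp del: mult_eq_0_iff)
    have "(0::complex)\<^sup>2 * k 0 - 2 * h 0 = 0"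
      using 1 by (intro cancel[where f = "\<lambda>y. y" and p = "1/2" and g = "\<lambda>y. y\<^sup>2 * k y - 2 * h y"])
        (auto intro!: holomorphic_intros hol simp del: mult_eq_0_iff)
    then show False using nz[of 0] by simp
  qed
  then obtain q where q: "q \<in> ?D" "E q \<noteq> 0" by blast
  \<comment> \<open>\<open>W = 0\<close> is the differential equation. \<open>rep\<close> gives it
    only multiplied by \<open>E\<close>, \<open>b2\<close> and \<open>y^2\<close>; these factors are
    cancelled one at a time, each being nonzero somewhere in the disk (\<open>1/2\<close> serves for
    \<open>y^2\<close>).\<close>
  define W where "W = (\<lambda>z. k z * E z - 2 * h z * b1 z)"
  have holW: "W holomorphic_on ?D" unfolding W_def by (intro holomorphic_intros hol holE)
  have "E y * (b2 y * (y\<^sup>2 * W y)) = 0" if y: "y \<in> ?D" for y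
  proof (cases "y = 0 \<or> b2 y = 0 \<or> E y = 0")
    case False
    have "y\<^sup>2 * (b1 y / b2 y) - 1 = E y / b2 y" using False by (simp add: E_def field_simps)
    then have "(y\<^sup>2 * k y - 2 * h y) * E y = 2 * b2 y * h y"
      using rep[of y] False y nz[OF y] by (simp add: field_simps)
    moreover have "y\<^sup>2 * W y = (y\<^sup>2 * k y - 2 * h y) * E y - 2 * b2 y * h y"
      by (simp add: W_def E_def algebra_simps)
    ultimately show ?thesis by simp
  qed auto
  then have 1: "b2 y * (y\<^sup>2 * W y) = 0" if "y \<in> ?D" for y
    using that q by (intro cancel[where f = E and p = q and g = "\<lambda>y. b2 y * (y\<^sup>2 * W y)"])
      (auto intro!: holomorphic_intros hol holW holE simp del: mult_eq_0_iff)
  have 2: "y\<^sup>2 * W y = 0" if "y \<in> ?D" for y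
    using that p 1 by (intro cancel[where f = b2 and p = p and g = "\<lambda>y. y\<^sup>2 * W y"])
      (auto intro!: holomorphic_intros hol holW simp del: mult_eq_0_iff)
  have "W z = 0"
    using 2 z by (intro cancel[where f = "\<lambda>y. y\<^sup>2" and p = "1/2" and g = W])
      (auto intro!: holomorphic_intros holW simp del: mult_eq_0_iff)
  then show ode: "k z * (z\<^sup>2 * b1 z - b2 z) = 2 * h z * b1 z" by (simp add: W_def E_def)
  show "z\<^sup>2 * b1 z - b2 z \<noteq> 0"
  proof
    assume "z\<^sup>2 * b1 z - b2 z = 0"
    \<comment> \<open>The equation forces \<open>b1 z = 0\<close>, hence \<open>b2 z = 0\<close>: a
      common zero.\<close>
    then show False using ode nz[OF z] ncz[OF z] by auto
  qed
qed

section \<open>Growth of the regularized derivative along rays ending on the circle\<close>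

text \<open>By \<open>growth\<close>, \<open>ln (norm (h z)) + k * ln s\<close> is nonincreasing in
  \<open>s\<close> along the ray, so \<open>norm (h z)\<close> is at least a positive multiple of
  \<open>1 / s\<close> to the power \<open>k\<close>. The ray is not tangential, so its distance to
  the circle is comparable with \<open>s\<close> and \<open>bound\<close> allows only order
  \<open>1 / s\<close>; for \<open>k > 1\<close> these clash.\<close>

lemma no_fast_growth_along_ray:
  fixes h :: "complex \<Rightarrow> complex"
  assumes holh: "h holomorphic_on ball 0 1" and nz: "\<And>z. z \<in> ball 0 1 \<Longrightarrow> h z \<noteq> 0"
    and bound: "\<And>z. z \<in> ball 0 1 \<Longrightarrow> norm (h z) \<le> C / (1 - norm z)"
    and z0: "norm z0 = 1" and w: "norm w = 1" "Re (w * cnj z0) < 0"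
    and k: "k > 1" and s0: "s0 > 0"
    and growth: "\<And>s. \<lbrakk>0 < s; s < s0; z0 + of_real s * w \<in> ball 0 1\<rbrakk> \<Longrightarrow>
        Re (w * deriv h (z0 + of_real s * w) / h (z0 + of_real s * w)) \<le> - k / s"
  shows False
proof -
  define \<sigma> where "\<sigma> = - Re (w * cnj z0)"
  have \<sigma>: "\<sigma> > 0" using w by (simp add: \<sigma>_def)
  \<comment> \<open>Halving makes both inequalities strict; \<open>s1 < \<sigma>\<close> ensures
    \<open>s^2 \<le> \<sigma> * s\<close>, which keeps the ray inside the disk up to
    \<open>s1\<close>.\<close>
  define s1 where "s1 = min s0 \<sigma> / 2"
  have s1: "s1 > 0" "s1 < s0" "s1 < \<sigma>" using s0 \<sigma> by (auto simp: s1_def)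
  let ?z = "\<lambda>s::real. z0 + of_real s * w"
  have sq: "(norm (?z s))\<^sup>2 = 1 - 2 * \<sigma> * s + s\<^sup>2" for s
  proof -
    have "(norm (?z s))\<^sup>2 = (norm z0)\<^sup>2 + s\<^sup>2 * (norm w)\<^sup>2 + 2 * s * Re (w * cnj z0)"
      unfolding cmod_power2 by (simp add: power2_eq_square algebra_simps)
    then show ?thesis using z0 w(1) by (simp add: \<sigma>_def del: times_complex.simps)
  qed
  have inner: "1 - norm (?z s) \<ge> \<sigma> * s / 2" if "0 < s" "s \<le> s1" for s
  proof -
    have "s\<^sup>2 \<le> \<sigma> * s" using that s1 by (simp add: power2_eq_square)
    then have a: "(norm (?z s))\<^sup>2 \<le> 1 - \<sigma> * s" using sq[of s] by (simp add: algebra_simps)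
    also have "\<dots> \<le> 1 - \<sigma> * s + (\<sigma> * s / 2)\<^sup>2" by simp
    also have "\<dots> = (1 - \<sigma> * s / 2)\<^sup>2" by (simp add: power2_eq_square algebra_simps)
    finally have "\<bar>norm (?z s)\<bar> \<le> \<bar>1 - \<sigma> * s / 2\<bar>" by (simp only: abs_le_square_iff)
    moreover have "0 \<le> 1 - \<sigma> * s" using a by (smt (verit) zero_le_power2)
    ultimately show ?thesis by auto
  qed
  have ins: "?z s \<in> ball 0 1" if "0 < s" "s \<le> s1" for s
    using inner[OF that] that \<sigma> by (smt (verit) divide_pos_pos mem_ball_0 mult_pos_pos)
  \<comment> \<open>A zero-free function on the disk has a holomorphic logarithm;
    \<open>Re (L z)\<close> is the logarithm of \<open>norm (h z)\<close>.\<close>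
  obtain L where L: "L holomorphic_on ball 0 1" "\<And>z. z \<in> ball 0 1 \<Longrightarrow> h z = exp (L z)"
    using contractible_imp_holomorphic_log[OF holh convex_imp_contractible nz] by auto
  have dL: "deriv h z / h z = deriv L z" if "z \<in> ball 0 1" for z
  proof -
    have "(L has_field_derivative deriv L z) (at z)"
      using L(1) that by (simp add: holomorphic_derivI)
    then have "((\<lambda>z. exp (L z)) has_field_derivative exp (L z) * deriv L z) (at z)"
      by (auto intro!: derivative_eq_intros)
    then have "(h has_field_derivative exp (L z) * deriv L z) (at z)"
      by (rule has_field_derivative_transform_within_open[of _ _ _ "ball 0 1"]) (use that L in auto)
    then show ?thesis using L(2)[OF that] by (simp add: DERIV_imp_deriv)
  qed
  define u where "u s = Re (L (?z s)) + k * ln s" for s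
  have du: "\<exists>y. DERIV u s :> y \<and> y \<le> 0" if "0 < s" "s \<le> s1" for s
  proof -
    have z': "(?z has_vector_derivative w) (at s)"
      by (auto intro!: derivative_eq_intros simp: has_vector_derivative_def scaleR_conv_of_real)
    have "(L has_field_derivative deriv L (?z s)) (at (?z s))"
      using L(1) ins[OF that] by (simp add: holomorphic_derivI)
    then have "((\<lambda>x. L (?z x)) has_vector_derivative w * deriv L (?z s)) (at s)"
      using field_vector_diff_chain_at[OF z', of L "deriv L (?z s)"] by (simp add: o_def)
    then have "((\<lambda>x. Re (L (?z x))) has_vector_derivative Re (w * deriv L (?z s))) (at s)"
      by (rule bounded_linear.has_vector_derivative[OF bounded_linear_Re])
    then have "((\<lambda>x. Re (L (?z x))) has_real_derivative Re (w * deriv L (?z s))) (at s)"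
      by (simp add: has_real_derivative_iff_has_vector_derivative)
    from DERIV_add[OF this DERIV_cmult[OF DERIV_ln[OF that(1)]]]
    have "DERIV u s :> Re (w * deriv L (?z s)) + k / s"
      by (simp add: u_def[abs_def] divide_inverse del: times_complex.simps)
    moreover have "Re (w * deriv L (?z s)) + k / s \<le> 0"
      using growth[OF that(1) _ ins[OF that]] that s1
      unfolding dL[OF ins[OF that], symmetric] times_divide_eq_right by linarith
    ultimately show ?thesis by blast
  qed
  have lower: "u s1 \<le> u s" if "0 < s" "s \<le> s1" for s
    by (rule DERIV_nonpos_imp_nonincreasing[OF that(2)]) (use that du in auto)
  have C: "C > 0"
  proof -
    have "0 < norm (h 0)" using nz by simp
    also have "\<dots> \<le> C" using bound[of 0] by simp
    finally show ?thesis .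
  qed
  have upper: "u s \<le> ln (2 * C / \<sigma>) + (k - 1) * ln s" if "0 < s" "s \<le> s1" for s
  proof -
    have "exp (Re (L (?z s))) = norm (h (?z s))" using L(2)[OF ins[OF that]] by simp
    also have "\<dots> \<le> C / (1 - norm (?z s))" by (rule bound[OF ins[OF that]])
    also have "\<dots> \<le> C / (\<sigma> * s / 2)"
      using C \<sigma> that inner[OF that] ins[OF that] by (intro divide_left_mono) (auto intro!: mult_pos_pos)
    finally have "exp (Re (L (?z s))) \<le> 2 * C / \<sigma> / s" by (simp add: field_simps)
    then have "Re (L (?z s)) \<le> ln (2 * C / \<sigma> / s)" using C \<sigma> that by (simp add: ln_ge_iff)
    also have "\<dots> = ln (2 * C / \<sigma>) - ln s" using C \<sigma> that by (subst ln_div) auto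
    finally show ?thesis by (simp add: u_def algebra_simps)
  qed
  \<comment> \<open>As \<open>s\<close> tends to 0 the upper bound for \<open>u s\<close> falls
    below \<open>u s1\<close>, against \<open>lower\<close>.\<close>
  have "filterlim (\<lambda>s::real. (k - 1) * ln s) at_bot (at_right 0)"
    using k by (intro filterlim_tendsto_pos_mult_at_bot[OF tendsto_const _ ln_at_0]) auto
  then have "eventually (\<lambda>s. (k - 1) * ln s < u s1 - ln (2 * C / \<sigma>)) (at_right 0)"
    by (simp add: filterlim_at_bot_dense)
  moreover have "eventually (\<lambda>s. s \<in> {0<..<s1}) (at_right 0)"
    using s1 by (intro eventually_at_right_real)
  ultimately have "eventually (\<lambda>s::real. False) (at_right 0)"
  proof eventually_elim
    case (elim s)
    then show ?case using lower[of s] upper[of s] by simp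
  qed
  then show False by simp
qed

text \<open>With \<phi> = \<open>z^2 * b1 z / b2 z\<close> the equation reads
  \<open>h' / h = 2 * \<phi> / (z * (\<phi> - 1))\<close>. Along the ray \<phi> - 1 is about
  \<open>norm (g \<zeta>) * s ^ m\<close>, so \<open>ln (norm (h z))\<close> has derivative about
  \<open>- \<eta> / s ^ m\<close>, where
  \<open>\<eta> = - 2 * Re (w * cnj \<zeta>) / norm (g \<zeta>)\<close>. For \<open>m = 1\<close>
  the hypothesis \<open>slope\<close> says \<open>\<eta> > 1\<close>; for \<open>m \<ge> 2\<close>
  any positive \<eta> is enough.\<close>

lemma no_crossing_with_slow_growth:
  fixes b1 b2 h k g :: "complex \<Rightarrow> complex"
  assumes holh: "h holomorphic_on ball 0 1" and nz: "\<And>z. z \<in> ball 0 1 \<Longrightarrow> h z \<noteq> 0"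
    and bound: "\<And>z. z \<in> ball 0 1 \<Longrightarrow> norm (h z) \<le> C / (1 - norm z)"
    and dh: "\<And>z. z \<in> ball 0 1 \<Longrightarrow> deriv h z = z * k z"
    and ode: "\<And>z. z \<in> ball 0 1 \<Longrightarrow> k z * (z\<^sup>2 * b1 z - b2 z) = 2 * h z * b1 z"
    and \<zeta>: "norm \<zeta> = 1" and w: "norm w = 1" "Re (w * cnj \<zeta>) < 0"
    and m: "0 < m" and r: "0 < r" and g: "g holomorphic_on ball \<zeta> r" "g \<zeta> \<noteq> 0"
    and factor: "\<And>z. z \<in> ball \<zeta> r \<Longrightarrow> b2 z \<noteq> 0 \<and> z\<^sup>2 * b1 z = b2 z * (1 + (z - \<zeta>) ^ m * g z)"
    and wg: "w ^ m * g \<zeta> = of_real (norm (g \<zeta>))"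
    and slope: "m = 1 \<Longrightarrow> norm (g \<zeta>) < - 2 * Re (w * cnj \<zeta>)"
  shows False
proof -
  define \<eta> where "\<eta> = - 2 * Re (w * cnj \<zeta>) / norm (g \<zeta>)"
  have \<eta>: "\<eta> > 0" using w(2) g(2) by (auto simp: \<eta>_def intro!: divide_neg_pos simp del: times_complex.simps)
  define y where "y s = \<zeta> + of_real s * w" for s :: real
  \<comment> \<open>This is \<open>s ^ m\<close> times the logarithmic derivative of
    \<open>h\<close> along the ray, in a form that has a limit as \<open>s\<close> tends to
    0.\<close>
  define \<Phi> where "\<Phi> s = 2 * w * (1 + (y s - \<zeta>) ^ m * g (y s)) / (y s * (w ^ m * g (y s)))" for s
  have growth_eq: "of_real (s ^ m) * (w * deriv h (y s) / h (y s)) = \<Phi> s"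
    if s: "s > 0" "y s \<in> ball 0 1" "y s \<in> ball \<zeta> r" "y s \<noteq> 0" for s
  proof -
    let ?z = "y s"
    let ?F = "(?z - \<zeta>) ^ m * g ?z"
    have F: "?F = of_real (s ^ m) * (w ^ m * g ?z)" by (simp add: y_def power_mult_distrib)
    have "?z\<^sup>2 * b1 ?z - b2 ?z = b2 ?z * ?F" using factor[OF s(3)] by (simp add: algebra_simps)
    then have "k ?z * (b2 ?z * ?F) = 2 * h ?z * b1 ?z" using ode[OF s(2)] by simp
    then have "b2 ?z * (?z\<^sup>2 * k ?z * ?F) = 2 * h ?z * (?z\<^sup>2 * b1 ?z)" by (simp add: algebra_simps)
    also have "\<dots> = b2 ?z * (2 * h ?z * (1 + ?F))" using factor[OF s(3)] by (simp add: algebra_simps)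
    finally have kF: "?z\<^sup>2 * k ?z * ?F = 2 * h ?z * (1 + ?F)" using factor[OF s(3)] by simp
    show ?thesis
    proof (cases "g ?z = 0")
      \<comment> \<open>Here \<open>kF\<close> would read \<open>0 = 2 * h ?z\<close>.\<close>
      case True
      then show ?thesis using kF nz[OF s(2)] by simp
    next
      case False
      have w0: "w \<noteq> 0" using w by auto
      have "?z * (?z * k ?z * (of_real (s ^ m) * (w ^ m * g ?z))) = 2 * h ?z * (1 + ?F)"
        using kF unfolding F by (simp add: power2_eq_square algebra_simps)
      then show ?thesis
        unfolding \<Phi>_def dh[OF s(2)] using False w0 s(4) nz[OF s(2)]
        by (simp add: field_simps)
    qed
  qed
  have y_lim: "(y \<longlongrightarrow> \<zeta>) (at_right 0)"
    unfolding y_def by (auto intro!: tendsto_eq_intros)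
  have g_cont: "isCont g \<zeta>"
    using g(1) r by (meson centre_in_ball continuous_on_eq_continuous_at holomorphic_on_imp_continuous_on open_ball)
  have "(\<Phi> \<longlongrightarrow> 2 * w * (1 + (\<zeta> - \<zeta>) ^ m * g \<zeta>) / (\<zeta> * (w ^ m * g \<zeta>))) (at_right 0)"
    unfolding \<Phi>_def using w \<zeta> g(2)
    by (intro tendsto_intros y_lim isCont_tendsto_compose[OF g_cont y_lim]) auto
  moreover have "2 * w * (1 + (\<zeta> - \<zeta>) ^ m * g \<zeta>) / (\<zeta> * (w ^ m * g \<zeta>)) = (2 * w * cnj \<zeta>) / of_real (norm (g \<zeta>))"
  proof -
    have "\<zeta> * cnj \<zeta> = 1" using \<zeta> by (simp add: complex_norm_square[symmetric])
    then have "2 * w / \<zeta> = 2 * w * cnj \<zeta>" using \<zeta> by (auto simp: divide_simps algebra_simps)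
    then show ?thesis unfolding wg using m by (simp add: zero_power flip: divide_divide_eq_left)
  qed
  ultimately have "((\<lambda>s. Re (\<Phi> s)) \<longlongrightarrow> Re ((2 * w * cnj \<zeta>) / of_real (norm (g \<zeta>)))) (at_right 0)"
    by (intro tendsto_Re) simp
  moreover have "Re ((2 * w * cnj \<zeta>) / of_real (norm (g \<zeta>))) = - \<eta>"
  proof -
    have "Re (2 * w * cnj \<zeta>) = 2 * Re (w * cnj \<zeta>)" by (simp add: algebra_simps)
    then show ?thesis unfolding Re_divide_of_real \<eta>_def by (simp del: times_complex.simps)
  qed
  ultimately have \<Phi>_lim: "((\<lambda>s. Re (\<Phi> s)) \<longlongrightarrow> - \<eta>) (at_right 0)" by simp
  have ev: "eventually (\<lambda>s. s > 0 \<and> y s \<in> ball \<zeta> r \<and> y s \<in> - {0}) (at_right 0)"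
  proof (intro eventually_conj)
    show "eventually (\<lambda>s::real. s > 0) (at_right 0)" by (simp add: eventually_at_right_less)
    show "eventually (\<lambda>s. y s \<in> ball \<zeta> r) (at_right 0)"
      using r by (intro topological_tendstoD[OF y_lim]) auto
    show "eventually (\<lambda>s. y s \<in> - {0}) (at_right 0)"
      using \<zeta> by (intro topological_tendstoD[OF y_lim]) auto
  qed
  \<comment> \<open>For \<open>m = 1\<close> the midpoint of 1 and \<eta> is taken; for larger
    \<open>m\<close> the value 2 works.\<close>
  obtain \<kappa> where \<kappa>: "\<kappa> > 1" and
    evk: "eventually (\<lambda>s. Re (\<Phi> s) / s ^ m \<le> - \<kappa> / s) (at_right 0)"
  proof (cases "m = 1")
    case True
    have "\<eta> > 1" using slope[OF True] g(2) by (simp add: \<eta>_def)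
    then have "- \<eta> < - ((1 + \<eta>) / 2)" by simp
    then have "eventually (\<lambda>s. Re (\<Phi> s) < - ((1 + \<eta>) / 2)) (at_right 0)"
      by (rule order_tendstoD(2)[OF \<Phi>_lim])
    then have "eventually (\<lambda>s. Re (\<Phi> s) / s ^ m \<le> - ((1 + \<eta>) / 2) / s) (at_right 0)"
      using ev
    proof eventually_elim
      case (elim s)
      then show ?case unfolding True power_one_right by (intro divide_right_mono) auto
    qed
    then show ?thesis using \<open>\<eta> > 1\<close> by (intro that[of "(1 + \<eta>) / 2"]) auto
  next
    case False
    obtain j where j: "m = Suc (Suc j)" using m False by (metis One_nat_def gr0_implies_Suc not0_implies_Suc)
    have "- \<eta> < - \<eta> / 2" using \<eta> by simp
    then have "eventually (\<lambda>s. Re (\<Phi> s) < - \<eta> / 2) (at_right 0)"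
      by (rule order_tendstoD(2)[OF \<Phi>_lim])
    \<comment> \<open>With \<open>m = j + 2\<close>, these bounds on \<open>s\<close> give
      \<open>2 * s ^ (m - 1) \<le> \<eta> / 2\<close>.\<close>
    moreover have "eventually (\<lambda>s::real. s \<in> {0<..<min 1 (\<eta> / 4)}) (at_right 0)"
      using \<eta> by (intro eventually_at_right_real) auto
    ultimately have "eventually (\<lambda>s. Re (\<Phi> s) / s ^ m \<le> - 2 / s) (at_right 0)"
    proof eventually_elim
      case (elim s)
      have s: "0 < s" "s \<le> 1" "s < \<eta> / 4" using elim by auto
      have "s ^ Suc j \<le> s * 1"
        unfolding power_Suc using s by (intro mult_left_mono power_le_one) auto
      then have "2 * s ^ Suc j \<le> \<eta> / 2" using s by linarith
      then have "Re (\<Phi> s) \<le> - 2 * s ^ Suc j" using elim by linarith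
      then have "Re (\<Phi> s) / s ^ m \<le> - 2 * s ^ Suc j / s ^ m" using s by (intro divide_right_mono) auto
      also have "\<dots> = - 2 / s" unfolding j using s by (simp add: field_simps)
      finally show ?case .
    qed
    then show ?thesis by (intro that[of 2]) auto
  qed
  obtain s0 where s0: "s0 > 0" "\<And>s. \<lbrakk>0 < s; s < s0\<rbrakk> \<Longrightarrow>
      y s \<in> ball \<zeta> r \<and> y s \<noteq> 0 \<and> Re (\<Phi> s) / s ^ m \<le> - \<kappa> / s"
    using eventually_conj[OF ev evk] unfolding eventually_at_right_field by auto
  show False
  proof (rule no_fast_growth_along_ray[OF holh nz bound \<zeta> w \<kappa> s0(1)])
    fix s :: real
    assume s: "0 < s" "s < s0" "\<zeta> + of_real s * w \<in> ball 0 1"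
    then have "of_real (s ^ m) * (w * deriv h (y s) / h (y s)) = \<Phi> s"
      using s0(2)[OF s(1,2)] by (intro growth_eq) (auto simp: y_def)
    then have "w * deriv h (y s) / h (y s) = \<Phi> s / of_real (s ^ m)"
      using s(1) by (simp add: field_simps)
    then have "Re (w * deriv h (y s) / h (y s)) = Re (\<Phi> s) / s ^ m"
      by (simp only: Re_divide_of_real)
    then show "Re (w * deriv h (\<zeta> + of_real s * w) / h (\<zeta> + of_real s * w)) \<le> - \<kappa> / s"
      using s0(2)[OF s(1,2)] by (simp add: y_def)
  qed
qed

section \<open>The lower bound\<close>

text \<open>In terms of \<open>R = (1 + r) / (1 - r)\<close> the hypothesis says
  \<open>q * R < 2 + sqrt (p * q + 4)\<close>: the positive number \<open>R\<close> lies below the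
  larger root of \<open>q * R^2 - 4 * R - p\<close>. Division by \<open>R\<close> gives the
  claim.\<close>

lemma below_first_bound:
  fixes p q r :: real
  assumes "0 \<le> r" "r < 1" "0 \<le> p" "0 < q" and "r < (sqrt (p * q + 4) + 2 - q) / (sqrt (p * q + 4) + 2 + q)"
  shows "q * ((1 + r) / (1 - r)) - p * ((1 - r) / (1 + r)) < 4"
proof -
  let ?s = "sqrt (p * q + 4)"
  define R where "R = (1 + r) / (1 - r)"
  have R: "R > 0" using assms by (simp add: R_def)
  have pq: "0 \<le> p * q" using assms by simp
  have "sqrt (2\<^sup>2) \<le> ?s" using pq by (intro real_sqrt_le_mono) auto
  then have s: "2 \<le> ?s" by simp
  have "r * (?s + 2 + q) < ?s + 2 - q" using assms s by (simp add: pos_less_divide_eq)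
  then have "q * (1 + r) < (?s + 2) * (1 - r)" by (simp add: algebra_simps)
  then have "q * R < ?s + 2" using assms by (simp add: R_def pos_divide_less_eq)
  moreover have "0 < q * R" using R assms by simp
  \<comment> \<open>The lower half of this bound comes from \<open>0 < q * R\<close> and
    \<open>2 \<le> ?s\<close>.\<close>
  ultimately have "\<bar>q * R - 2\<bar> < ?s" using s by linarith
  then have "\<bar>q * R - 2\<bar>\<^sup>2 < ?s\<^sup>2" by (intro power_strict_mono) auto
  then have "(q * R - 2)\<^sup>2 < p * q + 4" using pq by simp
  then have "q * (q * R\<^sup>2 - 4 * R - p) < 0" by (simp add: power2_eq_square algebra_simps)
  then have "q * R\<^sup>2 - 4 * R - p < 0" using assms by (simp add: mult_less_0_iff)
  then have "(q * R\<^sup>2 - 4 * R - p) / R < 0" using R by (simp add: divide_neg_pos)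
  then have "q * R - 4 - p / R < 0" using R by (simp add: diff_divide_distrib power2_eq_square)
  then show ?thesis by (simp add: R_def)
qed

text \<open>Here \<open>R\<close> is the reciprocal of the quantity in
  \<open>below_first_bound\<close>; the hypothesis puts it above the larger root of
  \<open>q * R^2 - 2 * R - p\<close>.\<close>

lemma below_second_bound:
  fixes p q r :: real
  assumes "0 \<le> r" "r < 1" "0 \<le> p" "0 < q" and "r < (q - 1 - sqrt (1 + p * q)) / (q + 1 + sqrt (1 + p * q))"
  shows "q * ((1 - r) / (1 + r)) - p * ((1 + r) / (1 - r)) > 2"
proof -
  let ?s = "sqrt (1 + p * q)"
  define R where "R = (1 - r) / (1 + r)"
  have R: "R > 0" using assms by (simp add: R_def)
  have pq: "0 \<le> p * q" using assms by simp
  then have s: "0 \<le> ?s" by simp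
  have "r * (q + 1 + ?s) < q - 1 - ?s" using assms s by (simp add: pos_less_divide_eq)
  then have "(1 + ?s) * (1 + r) < q * (1 - r)" by (simp add: algebra_simps)
  then have "1 + ?s < q * R" using assms by (simp add: R_def pos_less_divide_eq)
  then have "?s\<^sup>2 < (q * R - 1)\<^sup>2" using s by (intro power_strict_mono) auto
  then have "1 + p * q < (q * R - 1)\<^sup>2" using pq by simp
  then have "0 < q * (q * R\<^sup>2 - 2 * R - p)" by (simp add: power2_eq_square algebra_simps)
  then have "0 < q * R\<^sup>2 - 2 * R - p" using assms by (simp add: zero_less_mult_iff)
  then have "0 < (q * R\<^sup>2 - 2 * R - p) / R" using R by simp
  then have "0 < q * R - 2 - p / R" using R by (simp add: diff_divide_distrib power2_eq_square)
  then show ?thesis by (simp add: R_def)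
qed

theorem theorem10:
  fixes f B1 B2 :: "complex \<Rightarrow> complex" and n d1 d2 :: nat and r :: real
  assumes "schwarz_christoffel_exterior (n + 2) f"
    and "finite_blaschke d1 B1" and "finite_blaschke d2 B2"
    and "\<not> (\<exists>z\<in>ball 0 1. B1 z = 0 \<and> B2 z = 0)"
    and "d1 + d2 = n" and "d2 \<ge> 1"
    and "blaschke_representation f B1 B2"
    and "r < 1"
    and "\<forall>z\<in>ball 0 1. B1 z = 0 \<or> B2 z = 0 \<longrightarrow> norm z \<le> r"
  shows "r \<ge> max ((sqrt (real d1 * real d2 + 4) + 2 - real d2) /
                   (sqrt (real d1 * real d2 + 4) + 2 + real d2))
                  ((real d2 - 1 - sqrt (1 + real d1 * real d2)) /
                   (real d2 + 1 + sqrt (1 + real d1 * real d2)))"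
proof -
  let ?U = "ball 0 1 :: complex set"
  obtain c1 a where a: "norm c1 = 1" "\<forall>k<d1. norm (a k) < 1"
    and B1: "\<And>z. z \<in> ?U \<Longrightarrow> B1 z = c1 * blaschke_prod d1 a z"
    using assms(2) unfolding finite_blaschke_def blaschke_prod_def by metis
  obtain c2 b where b: "norm c2 = 1" "\<forall>k<d2. norm (b k) < 1"
    and B2: "\<And>z. z \<in> ?U \<Longrightarrow> B2 z = c2 * blaschke_prod d2 b z"
    using assms(3) unfolding finite_blaschke_def blaschke_prod_def by metis
  \<comment> \<open>\<open>B1\<close> and \<open>B2\<close> are determined only inside the disk;
    \<open>b1\<close> and \<open>b2\<close> agree with them there and continue holomorphically past
    the circle.\<close>
  define b1 where "b1 z = c1 * blaschke_prod d1 a z" for z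
  define b2 where "b2 z = c2 * blaschke_prod d2 b z" for z
  have c0: "c1 \<noteq> 0" "c2 \<noteq> 0" using a(1) b(1) by auto
  have b1_0: "b1 z = 0 \<longleftrightarrow> (\<exists>k<d1. z = a k)" and b2_0: "b2 z = 0 \<longleftrightarrow> (\<exists>k<d2. z = b k)"
    if "norm z \<le> 1" for z
    using that a b c0 by (simp_all add: b1_def b2_def blaschke_prod_eq_0_iff)
  have ncz: False if "z \<in> ?U" "b1 z = 0" "b2 z = 0" for z
    using that assms(4) B1[OF that(1)] B2[OF that(1)] by (auto simp: b1_def b2_def)
  have a_le: "norm (a k) \<le> r" if "k < d1" for k
  proof -
    have n: "norm (a k) < 1" using a(2) that by simp
    then have "b1 (a k) = 0" using b1_0[of "a k"] that by auto
    then show ?thesis using assms(9) B1[of "a k"] n by (simp add: b1_def)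
  qed
  have b_le: "norm (b k) \<le> r" if "k < d2" for k
  proof -
    have n: "norm (b k) < 1" using b(2) that by simp
    then have "b2 (b k) = 0" using b2_0[of "b k"] that by auto
    then show ?thesis using assms(9) B2[of "b k"] n by (simp add: b2_def)
  qed
  have d2: "0 < d2" using assms(6) by simp
  then have "norm (b 0) < 1" using b(2) by blast
  then have b_0: "b 0 \<in> ?U" "b2 (b 0) = 0" using b2_0[of "b 0"] d2 by auto
  \<comment> \<open>Nonnegativity of \<open>r\<close> comes from the zero \<open>b 0\<close> of
    \<open>B2\<close>, which exists because \<open>d2 \<ge> 1\<close>.\<close>
  have r0: "0 \<le> r" using b_le[of 0] assms(6) norm_ge_zero[of "b 0"] by linarith

  define S where "S = {z. \<forall>k<d1. 1 - cnj (a k) * z \<noteq> 0} \<inter> {z. \<forall>k<d2. 1 - cnj (b k) * z \<noteq> 0}"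
  have "open {z. \<forall>k<d. 1 - cnj (c k) * z \<noteq> 0}" for d :: nat and c
  proof -
    have "{z. \<forall>k<d. 1 - cnj (c k) * z \<noteq> 0} = (\<Inter>k<d. {z. 1 - cnj (c k) * z \<noteq> 0})" by auto
    then show ?thesis by (auto intro!: open_INT open_Collect_neq continuous_intros)
  qed
  then have S: "open S" "cball 0 1 \<subseteq> S"
    using a(2) b(2) one_minus_cnj_mult_nonzero by (auto simp: S_def intro!: open_Int)
  have hol: "b1 holomorphic_on S" "b2 holomorphic_on S"
    unfolding b1_def b2_def S_def
    by (intro holomorphic_intros holomorphic_on_subset[OF blaschke_prod_holomorphic_on]; blast)+
  have "ball 0 1 \<subseteq> S" using S(2) by auto
  then have holU: "b1 holomorphic_on ?U" "b2 holomorphic_on ?U" using hol by (auto intro: holomorphic_on_subset)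

  define P where "P a z = (1 - (norm a)\<^sup>2) / (norm (z - a))\<^sup>2" for a z :: complex
  define v where "v z = 2 + (\<Sum>k<d1. P (a k) z) - (\<Sum>k<d2. P (b k) z)" for z
  define R where "R = (1 + r) / (1 - r)"
  define R' where "R' = (1 - r) / (1 + r)"
  have P_bounds: "R' \<le> P c z" "P c z \<le> R" if "norm c \<le> r" "norm z = 1" for c z
    using poisson_kernel_bounds[OF that(1) assms(8) that(2)] by (simp_all add: P_def R_def R'_def)
  have v_bounds: "2 + real d1 * R' - real d2 * R \<le> v z" "v z \<le> 2 + real d1 * R - real d2 * R'"
    if z: "norm z = 1" for z
  proof -
    have "real d1 * R' \<le> (\<Sum>k<d1. P (a k) z)" "real d2 * R' \<le> (\<Sum>k<d2. P (b k) z)"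
      using P_bounds(1)[OF a_le z] P_bounds(1)[OF b_le z]
        sum_bounded_below[of "{..<d1}" R' "\<lambda>k. P (a k) z"] sum_bounded_below[of "{..<d2}" R' "\<lambda>k. P (b k) z"]
      by auto
    moreover have "(\<Sum>k<d1. P (a k) z) \<le> real d1 * R" "(\<Sum>k<d2. P (b k) z) \<le> real d2 * R"
      using P_bounds(2)[OF a_le z] P_bounds(2)[OF b_le z]
        sum_bounded_above[of "{..<d1}" "\<lambda>k. P (a k) z" R] sum_bounded_above[of "{..<d2}" "\<lambda>k. P (b k) z" R]
      by auto
    ultimately show "2 + real d1 * R' - real d2 * R \<le> v z" "v z \<le> 2 + real d1 * R - real d2 * R'"
      by (auto simp: v_def)
  qed
  have unimod: "norm (b1 z) = 1" "norm (b2 z) = 1" if "norm z = 1" for z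
    using that a b by (simp_all add: b1_def b2_def norm_mult norm_blaschke_prod_circle)
  have d_b1: "(b1 has_field_derivative b1 z / z * of_real (\<Sum>k<d1. P (a k) z)) (at z)"
    and d_b2: "(b2 has_field_derivative b2 z / z * of_real (\<Sum>k<d2. P (b k) z)) (at z)" if "norm z = 1" for z
    using DERIV_cmult[OF blaschke_prod_has_field_derivative[OF a(2) that], of c1]
      DERIV_cmult[OF blaschke_prod_has_field_derivative[OF b(2) that], of c2]
    by (simp_all add: b1_def[abs_def] b2_def[abs_def] P_def algebra_simps)
  have d_num: "((\<lambda>z. z\<^sup>2 * b1 z) has_field_derivative (z\<^sup>2 * b1 z) / z * of_real (2 + (\<Sum>k<d1. P (a k) z))) (at z)"
    if z: "norm z = 1" for z
  proof -
    have "z \<noteq> 0" using z by auto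
    then show ?thesis
      by (auto intro!: derivative_eq_intros d_b1[OF z] simp: power2_eq_square field_simps)
  qed
  have circle: "norm (z\<^sup>2 * b1 z) = norm (b2 z) \<and> z\<^sup>2 * b1 z \<noteq> 0 \<and> b2 z \<noteq> 0" if "norm z = 1" for z
    using unimod[OF that] that by (auto simp: norm_mult norm_power)
  have d_quot: "((\<lambda>z. z\<^sup>2 * b1 z / b2 z) has_field_derivative of_real (v z) / z) (at z)"
      "((\<lambda>z. b2 z / (z\<^sup>2 * b1 z)) has_field_derivative of_real (- v z) / z) (at z)"
    if z: "norm z = 1" and eq: "z\<^sup>2 * b1 z = b2 z" for z
  proof -
    have nz: "z \<noteq> 0" "b2 z \<noteq> 0" using circle[OF z] z by auto
    show "((\<lambda>z. z\<^sup>2 * b1 z / b2 z) has_field_derivative of_real (v z) / z) (at z)"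
      using logarithmic_derivative_quotient[OF d_num[OF z] d_b2[OF z] eq] nz by (simp add: v_def)
    show "((\<lambda>z. b2 z / (z\<^sup>2 * b1 z)) has_field_derivative of_real (- v z) / z) (at z)"
      using logarithmic_derivative_quotient[OF d_b2[OF z] d_num[OF z] eq[symmetric]] nz eq
      by (simp add: v_def)
  qed

  have f: "f holomorphic_on (?U - {0})" "is_pole f 0" "inj_on f (?U - {0})"
    using assms(1) by (auto simp: schwarz_christoffel_exterior_def)
  obtain h k C where hk: "h holomorphic_on ?U" "k holomorphic_on ?U"
    "\<And>z. z \<in> ?U \<Longrightarrow> h z \<noteq> 0" "\<And>z. z \<in> ?U \<Longrightarrow> deriv h z = z * k z"
    "\<And>z. z \<in> ?U - {0} \<Longrightarrow> z * (deriv (deriv f) z / deriv f z) = (z\<^sup>2 * k z - 2 * h z) / h z"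
    "\<And>z. z \<in> ?U \<Longrightarrow> norm (h z) \<le> C / (1 - norm z)"
    using exterior_map_derivatives[OF f] by blast
  have rep: "(z\<^sup>2 * k z - 2 * h z) / h z = 2 / (z\<^sup>2 * (b1 z / b2 z) - 1)"
    if "z \<in> ?U - {0}" "b2 z \<noteq> 0" for z
    using assms(7) that hk(5)[OF that(1)] B1[of z] B2[of z]
    by (auto simp: blaschke_representation_def b1_def b2_def)
  \<comment> \<open>\<open>b2\<close> has only finitely many zeros, so the disk contains a point
    where it is nonzero, as the cancellation in \<open>blaschke_ode\<close> requires.\<close>
  have "infinite (?U - b ` {..<d2})"
    using uncountable_ball[of 1 "0::complex"] countable_finite by (intro Diff_infinite_finite) auto
  then obtain p where p: "p \<in> ?U" "p \<notin> b ` {..<d2}" by (metis DiffE ex_in_conv finite.emptyI)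
  then have p': "b2 p \<noteq> 0" using b2_0[of p] by auto
  have ode: "k z * (z\<^sup>2 * b1 z - b2 z) = 2 * h z * b1 z" "z\<^sup>2 * b1 z - b2 z \<noteq> 0"
    if z: "z \<in> ?U" for z
    by (rule blaschke_ode[OF hk(1,2) holU _ _ p(1) p' _ z]; use hk(3) ncz rep in blast)+
  have hol_num: "(\<lambda>z. z\<^sup>2 * b1 z) holomorphic_on S" by (intro holomorphic_intros hol)

  have "\<not> r < (sqrt (real d1 * real d2 + 4) + 2 - real d2) / (sqrt (real d1 * real d2 + 4) + 2 + real d2)"
  proof
    assume "r < (sqrt (real d1 * real d2 + 4) + 2 - real d2) / (sqrt (real d1 * real d2 + 4) + 2 + real d2)"
    then have "real d2 * R - real d1 * R' < 4"
      unfolding R_def R'_def using assms(6,8) r0 by (intro below_first_bound) auto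
    then have v: "- 2 < v z" if "norm z = 1" for z using v_bounds(1)[OF that] by linarith
    have neq: "z\<^sup>2 * b1 z \<noteq> b2 z" if "z \<in> ?U" for z using ode(2)[OF that] by auto
    obtain \<zeta> w g m \<rho> where \<zeta>: "norm \<zeta> = 1" "\<zeta>\<^sup>2 * b1 \<zeta> = b2 \<zeta>"
      and w: "norm w = 1" "Re (w * cnj \<zeta>) < 0" and m: "0 < m" and \<rho>: "0 < \<rho>"
      and g: "g holomorphic_on ball \<zeta> \<rho>" "g \<zeta> \<noteq> 0"
      and factor: "\<And>z. z \<in> ball \<zeta> \<rho> \<Longrightarrow> b2 z \<noteq> 0 \<and> z\<^sup>2 * b1 z = b2 z * (1 + (z - \<zeta>) ^ m * g z)"
      and wg: "w ^ m * g \<zeta> = of_real (norm (g \<zeta>))"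
      using unimodular_quotient_crossing[OF S hol_num hol(2) _ neq b_0] circle by metis
    have first: "m \<noteq> 1 \<Longrightarrow> v \<zeta> = 0" "m = 1 \<Longrightarrow> norm (g \<zeta>) = \<bar>v \<zeta>\<bar>"
        "m = 1 \<Longrightarrow> Re (w * cnj \<zeta>) * v \<zeta> = \<bar>v \<zeta>\<bar>"
      by (rule crossing_first_order[OF \<zeta>(1) m \<rho> g(1) factor wg d_quot(1)[OF \<zeta>]]; assumption)+
    show False
    proof (rule no_crossing_with_slow_growth[OF hk(1,3,6,4) _ \<zeta>(1) w m \<rho> g factor wg])
      show "k z * (z\<^sup>2 * b1 z - b2 z) = 2 * h z * b1 z" if "z \<in> ?U" for z by (rule ode(1)[OF that])
      assume m1: "m = 1"
      \<comment> \<open>The relation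
        \<open>Re (w * cnj \<zeta>) * v \<zeta> = \<bar>v \<zeta>\<bar>\<close> with inward
        \<open>w\<close> forces \<open>v \<zeta> < 0\<close> and
        \<open>Re (w * cnj \<zeta>) = - 1\<close>: the approach is radial, and the slope condition
        becomes \<open>\<bar>v \<zeta>\<bar> < 2\<close>.\<close>
      have "v \<zeta> \<noteq> 0" using first(2)[OF m1] g(2) by auto
      then have "0 < Re (w * cnj \<zeta>) * v \<zeta>" unfolding first(3)[OF m1] by simp
      then have "v \<zeta> < 0" using w(2) by (simp add: zero_less_mult_iff del: times_complex.simps)
      moreover from this have "(Re (w * cnj \<zeta>) + 1) * v \<zeta> = 0"
        using first(3)[OF m1] by (simp add: algebra_simps del: times_complex.simps)
      ultimately have "Re (w * cnj \<zeta>) = - 1" by (simp del: times_complex.simps)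
      then show "norm (g \<zeta>) < - 2 * Re (w * cnj \<zeta>)"
        using first(2)[OF m1] \<open>v \<zeta> < 0\<close> v[OF \<zeta>(1)] by linarith
    qed
  qed
  moreover have "\<not> r < (real d2 - 1 - sqrt (1 + real d1 * real d2)) / (real d2 + 1 + sqrt (1 + real d1 * real d2))"
  proof
    assume "r < (real d2 - 1 - sqrt (1 + real d1 * real d2)) / (real d2 + 1 + sqrt (1 + real d1 * real d2))"
    then have "2 < real d2 * R' - real d1 * R"
      unfolding R_def R'_def using assms(6,8) r0 by (intro below_second_bound) auto
    then have v: "v z < 0" if "norm z = 1" for z using v_bounds(2)[OF that] by linarith
    have neq: "b2 z \<noteq> z\<^sup>2 * b1 z" if "z \<in> ?U" for z using ode(2)[OF that] by auto
    \<comment> \<open>Numerator and denominator are exchanged: the reciprocal quotient has a pole at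
      0, from the factor \<open>z^2\<close>.\<close>
    have zero: "(0::complex) \<in> ?U" "(0::complex)\<^sup>2 * b1 0 = 0" by auto
    obtain \<zeta> w g m \<rho> where \<zeta>: "norm \<zeta> = 1" "b2 \<zeta> = \<zeta>\<^sup>2 * b1 \<zeta>"
      and w: "norm w = 1" "Re (w * cnj \<zeta>) < 0" and m: "0 < m" and \<rho>: "0 < \<rho>"
      and g: "g holomorphic_on ball \<zeta> \<rho>" "g \<zeta> \<noteq> 0"
      and factor: "\<And>z. z \<in> ball \<zeta> \<rho> \<Longrightarrow> z\<^sup>2 * b1 z \<noteq> 0 \<and> b2 z = z\<^sup>2 * b1 z * (1 + (z - \<zeta>) ^ m * g z)"
      and wg: "w ^ m * g \<zeta> = of_real (norm (g \<zeta>))"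
      using unimodular_quotient_crossing[OF S hol(2) hol_num _ neq zero] circle by metis
    have first: "m \<noteq> 1 \<Longrightarrow> - v \<zeta> = 0" "m = 1 \<Longrightarrow> Re (w * cnj \<zeta>) * - v \<zeta> = \<bar>- v \<zeta>\<bar>"
      by (rule crossing_first_order[OF \<zeta>(1) m \<rho> g(1) factor wg d_quot(2)[OF \<zeta>(1) \<zeta>(2)[symmetric]]]; assumption)+
    \<comment> \<open>Since \<open>- v \<zeta> > 0\<close>, the relation for \<open>m = 1\<close>
      would need \<open>Re (w * cnj \<zeta>) = 1\<close>, an outward direction.\<close>
    have "m = 1" using first(1) v[OF \<zeta>(1)] by auto
    then have "Re (w * cnj \<zeta>) * - v \<zeta> = \<bar>- v \<zeta>\<bar>" by (rule first(2))
    moreover have "Re (w * cnj \<zeta>) * - v \<zeta> < 0"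
      using w(2) v[OF \<zeta>(1)] by (intro mult_neg_pos) auto
    ultimately show False by linarith
  qed
  ultimately show ?thesis by simp
qed

end
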